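(* Let $p>0$ be a prime integer, and consider: \begin{enumerate} \item[(a)] $R=\mathbb{Z}[X]/(\det X)$, where $X$ is an $n\times n$ matrix of indeterminates over $\mathbb{Z}$, $n\geqslant 3$; \item[(b)] $R=\mathbb{Z}[X]/(\operatorname{pf}X)$, where $X$ is an $n\times n$ alternating matrix of indeterminates over $\mathbb{Z}$ and $n\geqslant 4$ is even ($\operatorname{pf}$ = Pfaffian); \item[(c)] $R=\mathbb{Z}[X]/(\det X)$, where $X$ is an $n\times n$ symmetric matrix of indeterminates over $\mathbb{Z}$, $n\geqslant 3$. \end{enumerate} In cases (a) and (b), the Frobenius endomorphism of $R/pR$ does not lift to a ring endomorphism of $R/p^2R$, nor, a fortiori, to a ring endomorphism of $R$. In case (c), the same conclusion holds if $p=2$, or if $p>2$ and $n\geqslant 4$.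
   Context: A lift of the Frobenius endomorphism $F$ of $R/pR$ to $R/p^2R$ is a ring endomorphism $\Lambda$ of $R/p^2R$ such that reducing modulo $p$ gives $F$, i.e. $\Lambda(r)\equiv r^p \pmod{p}$ for all $r$. *)

theory Defs
  imports "HOL-Algebra.QuotRing" "HOL-Library.Poly_Mapping" "HOL-Combinatorics.Permutations" "HOL-Computational_Algebra.Primes"
begin

type_synonym 'v mpoly = "('v \<Rightarrow>\<^sub>0 nat) \<Rightarrow>\<^sub>0 int"

definition mpoly_ring :: "'v set \<Rightarrow> 'v mpoly ring" where
  "mpoly_ring V = \<lparr>carrier = {P :: 'v mpoly. \<forall>m \<in> Poly_Mapping.keys P. Poly_Mapping.keys m \<subseteq> V},
                   monoid.mult = (\<lambda>x y. x * y), one = 1, zero = 0, add = (\<lambda>x y. x + y)\<rparr>"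

definition Var :: "'v \<Rightarrow> 'v mpoly" where
  "Var v = Poly_Mapping.single (Poly_Mapping.single v 1) 1"

definition hyp_ring :: "'v set \<Rightarrow> 'v mpoly \<Rightarrow> 'v mpoly set ring" where
  "hyp_ring V f = mpoly_ring V Quot genideal (mpoly_ring V) {f}"

definition det_n :: "nat \<Rightarrow> (nat \<Rightarrow> nat \<Rightarrow> 'a::comm_ring_1) \<Rightarrow> 'a" where
  "det_n n A = (\<Sum>\<sigma> \<in> {\<sigma>. \<sigma> permutes {..<n}}. of_int (sign \<sigma>) * (\<Prod>i<n. A i (\<sigma> i)))"

text \<open>Pfaffian of an n x n (n even) matrix: sum over permutations with
  sigma(2i) < sigma(2i+1) and sigma(0) < sigma(2) < ... (i.e. over perfect matchings).\<close>
definition pfaffian :: "nat \<Rightarrow> (nat \<Rightarrow> nat \<Rightarrow> 'a::comm_ring_1) \<Rightarrow> 'a" where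
  "pfaffian n A = (\<Sum>\<sigma> \<in> {\<sigma>. \<sigma> permutes {..<n}
        \<and> (\<forall>i < n div 2. \<sigma> (2*i) < \<sigma> (2*i+1))
        \<and> (\<forall>i. Suc i < n div 2 \<longrightarrow> \<sigma> (2*i) < \<sigma> (2*(Suc i)))}.
      of_int (sign \<sigma>) * (\<Prod>i < n div 2. A (\<sigma> (2*i)) (\<sigma> (2*i+1))))"

definition gen_vars :: "nat \<Rightarrow> (nat \<times> nat) set" where
  "gen_vars n = {..<n} \<times> {..<n}"
definition gen_matrix :: "nat \<Rightarrow> nat \<Rightarrow> (nat \<times> nat) mpoly" where
  "gen_matrix i j = Var (i, j)"

definition sym_vars :: "nat \<Rightarrow> (nat \<times> nat) set" where
  "sym_vars n = {(i, j). i \<le> j \<and> j < n}"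
definition sym_matrix :: "nat \<Rightarrow> nat \<Rightarrow> (nat \<times> nat) mpoly" where
  "sym_matrix i j = Var (min i j, max i j)"

definition alt_vars :: "nat \<Rightarrow> (nat \<times> nat) set" where
  "alt_vars n = {(i, j). i < j \<and> j < n}"
definition alt_matrix :: "nat \<Rightarrow> nat \<Rightarrow> (nat \<times> nat) mpoly" where
  "alt_matrix i j = (if i < j then Var (i, j) else if j < i then - Var (j, i) else 0)"

definition R_det :: "nat \<Rightarrow> (nat \<times> nat) mpoly set ring" where
  "R_det n = hyp_ring (gen_vars n) (det_n n gen_matrix)"
definition R_pf :: "nat \<Rightarrow> (nat \<times> nat) mpoly set ring" where
  "R_pf n = hyp_ring (alt_vars n) (pfaffian n alt_matrix)"
definition R_symdet :: "nat \<Rightarrow> (nat \<times> nat) mpoly set ring" where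
  "R_symdet n = hyp_ring (sym_vars n) (det_n n sym_matrix)"

definition nat_elem :: "('a, 'm) ring_scheme \<Rightarrow> nat \<Rightarrow> 'a" where
  "nat_elem R k = add_pow R k \<one>\<^bsub>R\<^esub>"

definition mod_nat :: "('a, 'm) ring_scheme \<Rightarrow> nat \<Rightarrow> 'a set ring" where
  "mod_nat R k = R Quot genideal R {nat_elem R k}"

definition is_frobenius_lift :: "('a, 'm) ring_scheme \<Rightarrow> nat \<Rightarrow> ('a \<Rightarrow> 'a) \<Rightarrow> bool" where
  "is_frobenius_lift S p L \<longleftrightarrow> L \<in> ring_hom S S \<and>
     (\<forall>r \<in> carrier S. L r \<ominus>\<^bsub>S\<^esub> r [^]\<^bsub>S\<^esub> p \<in> genideal S {nat_elem S p})"

definition frob_lifts_mod_p2 :: "('a, 'm) ring_scheme \<Rightarrow> nat \<Rightarrow> bool" where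
  "frob_lifts_mod_p2 R p \<longleftrightarrow> (\<exists>L. is_frobenius_lift (mod_nat R (p^2)) p L)"

definition frob_lifts :: "('a, 'm) ring_scheme \<Rightarrow> nat \<Rightarrow> bool" where
  "frob_lifts R p \<longleftrightarrow> (\<exists>L. is_frobenius_lift R p L)"

end

theory Submission
  imports Defs "HOL-Library.Product_Plus"
begin

text \<open>
  Let \<open>f\<close> be the equation of the hypersurface. A lift of Frobenius modulo \<open>p\<^sup>2\<close> sends each
  variable \<open>v\<close> to \<open>v\<^sup>p + p g\<^sub>v\<close>, and \<open>f\<close> evaluated at these images lies in the ideal
  \<open>(f, p\<^sup>2)\<close>. Evaluate this relation at a point \<open>\<psi>\<close> of the hypersurface with coordinates in a
  polynomial ring over the integers: \<open>f (\<psi>\<^sup>p) + p \<Sum> g\<^sub>v (\<psi>) (\<partial>\<^sub>v f) (\<psi>\<^sup>p)\<close> is divisible by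
  \<open>p\<^sup>2\<close>. Taking \<open>\<psi>\<close> to be a small singular matrix bordered by an identity matrix (by standard
  symplectic blocks for the Pfaffian), the border drops out modulo \<open>p\<^sup>2\<close>, since a term of the
  determinant that uses one off-diagonal border entry uses two of them. The small matrix is
  chosen such that some monomial has a coefficient in \<open>f (\<psi>\<^sup>p)\<close> that is divisible by \<open>p\<close> but not
  by \<open>p\<^sup>2\<close> (a binomial coefficient such as \<open>p choose 1\<close>), while its coefficient in each
  \<open>g\<^sub>v (\<psi>) (\<partial>\<^sub>v f) (\<psi>\<^sup>p)\<close> is divisible by \<open>p\<close> because \<open>g\<^sub>v (\<psi>)\<close> only involves monomials
  generated by the matrix entries.
\<close>

section \<open>Evaluation of integer polynomials\<close>

abbreviation mpolys :: "'v set \<Rightarrow> 'v mpoly set" where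
  "mpolys V \<equiv> carrier (mpoly_ring V)"

lemma mpolys_iff: "P \<in> mpolys V \<longleftrightarrow> (\<forall>m \<in> Poly_Mapping.keys P. Poly_Mapping.keys m \<subseteq> V)"
  by (simp add: mpoly_ring_def)

lemma mpoly_ring_simps [simp]:
  "x \<otimes>\<^bsub>mpoly_ring V\<^esub> y = x * y" "\<one>\<^bsub>mpoly_ring V\<^esub> = 1"
  "\<zero>\<^bsub>mpoly_ring V\<^esub> = 0" "x \<oplus>\<^bsub>mpoly_ring V\<^esub> y = x + y"
  by (simp_all add: mpoly_ring_def)

lemma mpolys_0 [simp]: "0 \<in> mpolys V" and mpolys_1 [simp]: "1 \<in> mpolys V"
  by (simp_all add: mpolys_iff)

lemma mpolys_add [simp]: "P \<in> mpolys V \<Longrightarrow> Q \<in> mpolys V \<Longrightarrow> P + Q \<in> mpolys V"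
  using Poly_Mapping.keys_add[of P Q] by (auto simp: mpolys_iff)

lemma mpolys_uminus [simp]: "P \<in> mpolys V \<Longrightarrow> - P \<in> mpolys V"
  by (auto simp: mpolys_iff in_keys_iff)

lemma mpolys_diff [simp]: "P \<in> mpolys V \<Longrightarrow> Q \<in> mpolys V \<Longrightarrow> P - Q \<in> mpolys V"
  using mpolys_add[of P V "- Q"] by simp

lemma mpolys_mult [simp]:
  assumes "P \<in> mpolys V" "Q \<in> mpolys V" shows "P * Q \<in> mpolys V"
  unfolding mpolys_iff
proof
  fix m assume "m \<in> Poly_Mapping.keys (P * Q)"
  then obtain a b where "m = a + b" "a \<in> Poly_Mapping.keys P" "b \<in> Poly_Mapping.keys Q"
    using Poly_Mapping.keys_mult[of P Q] by auto
  then show "Poly_Mapping.keys m \<subseteq> V"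
    using Poly_Mapping.keys_add[of a b] assms by (fastforce simp: mpolys_iff)
qed

lemma mpolys_power [simp]: "P \<in> mpolys V \<Longrightarrow> P ^ k \<in> mpolys V"
  by (induction k) auto

lemma mpolys_of_nat [simp]: "of_nat k \<in> mpolys V"
  by (induction k) auto

lemma mpolys_of_int [simp]: "of_int k \<in> mpolys V"
  by (cases k rule: int_cases2) auto

lemma mpolys_sum: "(\<And>x. x \<in> A \<Longrightarrow> f x \<in> mpolys V) \<Longrightarrow> sum f A \<in> mpolys V"
  by (induction A rule: infinite_finite_induct) auto

lemma mpolys_prod: "(\<And>x. x \<in> A \<Longrightarrow> f x \<in> mpolys V) \<Longrightarrow> prod f A \<in> mpolys V"
  by (induction A rule: infinite_finite_induct) auto

lemma mpolys_Var [simp]: "v \<in> V \<Longrightarrow> Var v \<in> mpolys V"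
  by (auto simp: mpolys_iff Var_def)

lemma cring_mpoly_ring: "cring (mpoly_ring V)"
proof (rule cringI)
  show "abelian_group (mpoly_ring V)"
  proof (rule abelian_groupI)
    fix P assume "P \<in> mpolys V"
    then show "\<exists>Q\<in>mpolys V. Q \<oplus>\<^bsub>mpoly_ring V\<^esub> P = \<zero>\<^bsub>mpoly_ring V\<^esub>"
      by (intro bexI[of _ "- P"]) auto
  qed (auto simp: algebra_simps)
  show "comm_monoid (mpoly_ring V)"
    by (rule comm_monoidI) (auto simp: algebra_simps)
qed (auto simp: algebra_simps)

lemma a_inv_mpoly_ring: "P \<in> mpolys V \<Longrightarrow> \<ominus>\<^bsub>mpoly_ring V\<^esub> P = - P"
proof -
  interpret cring "mpoly_ring V" by (rule cring_mpoly_ring)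
  assume "P \<in> mpolys V"
  then show ?thesis using minus_equality[of "-P" P] by simp
qed

lemma nat_pow_mpoly_ring: "P [^]\<^bsub>mpoly_ring V\<^esub> (k :: nat) = P ^ k"
  by (induction k) (simp_all add: mult.commute)

lemma mpoly_sum_singles:
  "(\<Sum>m\<in>Poly_Mapping.keys P. Poly_Mapping.single m (Poly_Mapping.lookup P m)) = P"
proof (rule poly_mapping_eqI)
  fix k
  show "Poly_Mapping.lookup (\<Sum>m\<in>Poly_Mapping.keys P. Poly_Mapping.single m (Poly_Mapping.lookup P m)) k
        = Poly_Mapping.lookup P k"
    by (cases "k \<in> Poly_Mapping.keys P")
       (simp_all add: lookup_sum lookup_single when_def in_keys_iff)
qed

section \<open>Evaluation homomorphisms and induction over polynomials\<close>

definition mon_eval :: "('v \<Rightarrow> 'b::comm_ring_1) \<Rightarrow> ('v \<Rightarrow>\<^sub>0 nat) \<Rightarrow> 'b" where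
  "mon_eval \<psi> m = (\<Prod>v\<in>Poly_Mapping.keys m. \<psi> v ^ Poly_Mapping.lookup m v)"

definition mpoly_eval :: "('v \<Rightarrow> 'b::comm_ring_1) \<Rightarrow> 'v mpoly \<Rightarrow> 'b" where
  "mpoly_eval \<psi> P = (\<Sum>m\<in>Poly_Mapping.keys P. of_int (Poly_Mapping.lookup P m) * mon_eval \<psi> m)"

lemma mon_eval_superset:
  "finite A \<Longrightarrow> Poly_Mapping.keys m \<subseteq> A \<Longrightarrow> mon_eval \<psi> m = (\<Prod>v\<in>A. \<psi> v ^ Poly_Mapping.lookup m v)"
  unfolding mon_eval_def by (rule prod.mono_neutral_left) (auto simp: in_keys_iff)

lemma mon_eval_0 [simp]: "mon_eval \<psi> 0 = 1"
  by (simp add: mon_eval_def)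

lemma mon_eval_add: "mon_eval \<psi> (a + b) = mon_eval \<psi> a * mon_eval \<psi> b"
proof -
  let ?A = "Poly_Mapping.keys a \<union> Poly_Mapping.keys b"
  have "Poly_Mapping.keys (a + b) \<subseteq> ?A" by (rule Poly_Mapping.keys_add)
  then show ?thesis
    by (simp add: mon_eval_superset[of ?A] lookup_add power_add prod.distrib)
qed

lemma mpoly_eval_superset:
  "finite A \<Longrightarrow> Poly_Mapping.keys P \<subseteq> A \<Longrightarrow>
    mpoly_eval \<psi> P = (\<Sum>m\<in>A. of_int (Poly_Mapping.lookup P m) * mon_eval \<psi> m)"
  unfolding mpoly_eval_def by (rule sum.mono_neutral_left) (auto simp: in_keys_iff)

lemma mpoly_eval_0 [simp]: "mpoly_eval \<psi> 0 = 0"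
  by (simp add: mpoly_eval_def)

lemma mpoly_eval_add [simp]: "mpoly_eval \<psi> (P + Q) = mpoly_eval \<psi> P + mpoly_eval \<psi> Q"
proof -
  let ?A = "Poly_Mapping.keys P \<union> Poly_Mapping.keys Q"
  have "Poly_Mapping.keys (P + Q) \<subseteq> ?A" by (rule Poly_Mapping.keys_add)
  then show ?thesis
    by (simp add: mpoly_eval_superset[of ?A] lookup_add algebra_simps sum.distrib)
qed

lemma mpoly_eval_sum [simp]: "mpoly_eval \<psi> (sum f A) = (\<Sum>x\<in>A. mpoly_eval \<psi> (f x))"
  by (induction A rule: infinite_finite_induct) auto

lemma mpoly_eval_single [simp]:
  "mpoly_eval \<psi> (Poly_Mapping.single m c) = of_int c * mon_eval \<psi> m"
  by (simp add: mpoly_eval_def)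

lemma mpoly_eval_mult [simp]: "mpoly_eval \<psi> (P * Q) = mpoly_eval \<psi> P * mpoly_eval \<psi> Q"
proof -
  have "P * Q = (\<Sum>a\<in>Poly_Mapping.keys P. \<Sum>b\<in>Poly_Mapping.keys Q.
      Poly_Mapping.single (a + b) (Poly_Mapping.lookup P a * Poly_Mapping.lookup Q b))"
    by (subst mpoly_sum_singles[of P, symmetric], subst mpoly_sum_singles[of Q, symmetric])
       (simp add: sum_product mult_single)
  then have "mpoly_eval \<psi> (P * Q) = (\<Sum>a\<in>Poly_Mapping.keys P. \<Sum>b\<in>Poly_Mapping.keys Q.
      of_int (Poly_Mapping.lookup P a * Poly_Mapping.lookup Q b) * mon_eval \<psi> (a + b))"
    by simp
  then show ?thesis
    by (simp add: mon_eval_add mpoly_eval_def[of _ P] mpoly_eval_def[of _ Q] sum_product mult_ac)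
qed

lemma mpoly_eval_1 [simp]: "mpoly_eval \<psi> 1 = 1"
  by (simp add: mpoly_eval_def)

lemma mpoly_eval_uminus [simp]: "mpoly_eval \<psi> (- P) = - mpoly_eval \<psi> P"
  using mpoly_eval_add[of \<psi> P "- P"] by (simp add: eq_neg_iff_add_eq_0 add.commute)

lemma mpoly_eval_diff [simp]: "mpoly_eval \<psi> (P - Q) = mpoly_eval \<psi> P - mpoly_eval \<psi> Q"
  using mpoly_eval_add[of \<psi> P "- Q"] by simp

lemma mpoly_eval_power [simp]: "mpoly_eval \<psi> (P ^ k) = mpoly_eval \<psi> P ^ k"
  by (induction k) auto

lemma mpoly_eval_of_nat [simp]: "mpoly_eval \<psi> (of_nat k) = of_nat k"
  by (induction k) auto

lemma mpoly_eval_of_int [simp]: "mpoly_eval \<psi> (of_int k) = of_int k"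
  by (cases k rule: int_cases2) auto

lemma mpoly_eval_prod [simp]: "mpoly_eval \<psi> (prod f A) = (\<Prod>x\<in>A. mpoly_eval \<psi> (f x))"
  by (induction A rule: infinite_finite_induct) auto

lemma mpoly_eval_Var [simp]: "mpoly_eval \<psi> (Var v) = \<psi> v"
  by (simp add: Var_def mon_eval_def)

lemma single_eq_prod_Var:
  "Poly_Mapping.single m c = of_int c * (\<Prod>v\<in>Poly_Mapping.keys m. Var v ^ Poly_Mapping.lookup m v)"
proof -
  have pow: "Var v ^ k = Poly_Mapping.single (Poly_Mapping.single v k) 1" for v :: 'a and k
    by (induction k) (simp_all add: Var_def mult_single single_add[symmetric])
  have "(\<Prod>v\<in>A. Var v ^ Poly_Mapping.lookup m v) =
      Poly_Mapping.single (\<Sum>v\<in>A. Poly_Mapping.single v (Poly_Mapping.lookup m v)) 1" for A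
    by (induction A rule: infinite_finite_induct) (simp_all add: pow mult_single)
  moreover have "(\<Sum>v\<in>Poly_Mapping.keys m. Poly_Mapping.single v (Poly_Mapping.lookup m v)) = m"
  proof (rule poly_mapping_eqI)
    fix k
    show "Poly_Mapping.lookup (\<Sum>v\<in>Poly_Mapping.keys m. Poly_Mapping.single v (Poly_Mapping.lookup m v)) k
        = Poly_Mapping.lookup m k"
      by (cases "k \<in> Poly_Mapping.keys m")
         (simp_all add: lookup_sum lookup_single when_def in_keys_iff)
  qed
  moreover have "Poly_Mapping.single m c = of_int c * Poly_Mapping.single m 1"
    by (simp add: single_of_int[symmetric] mult_single del: single_of_int)
  ultimately show ?thesis by metis
qed

text \<open>The polynomials in \<open>V\<close> form the subring generated by the variables:
  constants come from \<open>1\<close> by addition and negation. Homomorphisms out of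
  \<open>mpoly_ring V\<close> can thus be compared on variables.\<close>

lemma mpolys_induct [consumes 1, case_names one var add uminus mult]:
  assumes "P \<in> mpolys V"
    and one: "Q 1" and var: "\<And>v. v \<in> V \<Longrightarrow> Q (Var v)"
    and add: "\<And>A B. A \<in> mpolys V \<Longrightarrow> B \<in> mpolys V \<Longrightarrow> Q A \<Longrightarrow> Q B \<Longrightarrow> Q (A + B)"
    and uminus: "\<And>A. A \<in> mpolys V \<Longrightarrow> Q A \<Longrightarrow> Q (- A)"
    and mult: "\<And>A B. A \<in> mpolys V \<Longrightarrow> B \<in> mpolys V \<Longrightarrow> Q A \<Longrightarrow> Q B \<Longrightarrow> Q (A * B)"
  shows "Q P"
proof -
  have zero: "Q 0" using add[of 1 "-1"] uminus[of 1] one by simp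
  have nat: "Q (of_nat k)" for k by (induction k) (auto intro: add one zero)
  have int: "Q (of_int k)" for k
    by (cases k rule: int_cases2) (auto intro: uminus nat)
  have pow: "Q (Var v ^ k)" if "v \<in> V" for v k
    using that by (induction k) (auto intro: mult var one)
  have "Q (\<Prod>v\<in>A. Var v ^ m v)" if "A \<subseteq> V" for A and m :: "'a \<Rightarrow> nat"
    using that
    by (induction A rule: infinite_finite_induct) (auto intro!: mult pow one mpolys_prod)
  then have single: "Q (Poly_Mapping.single m c)" if "Poly_Mapping.keys m \<subseteq> V" for m c
    using that unfolding single_eq_prod_Var
    by (intro mult int) (auto intro!: mpolys_prod)
  have "Q (\<Sum>m\<in>A. Poly_Mapping.single m (Poly_Mapping.lookup P m))"
    if "A \<subseteq> Poly_Mapping.keys P" for A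
    using that \<open>P \<in> mpolys V\<close>
    by (induction A rule: infinite_finite_induct)
       (auto intro!: add zero single mpolys_sum simp: mpolys_iff)
  from this[of "Poly_Mapping.keys P"] show ?thesis by (simp add: mpoly_sum_singles)
qed

lemma mpoly_eval_mpoly_eval:
  "mpoly_eval \<psi> (mpoly_eval y P) = mpoly_eval (\<lambda>v. mpoly_eval \<psi> (y v)) P"
proof -
  have "P \<in> mpolys UNIV" by (simp add: mpolys_iff)
  then show ?thesis by (induction rule: mpolys_induct) auto
qed

lemma mpoly_eval_cong:
  "P \<in> mpolys V \<Longrightarrow> (\<And>v. v \<in> V \<Longrightarrow> \<psi> v = \<psi>' v) \<Longrightarrow> mpoly_eval \<psi> P = mpoly_eval \<psi>' P"
  by (induction rule: mpolys_induct) auto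

lemma mpoly_eval_mpolys:
  "P \<in> mpolys V \<Longrightarrow> (\<And>v. v \<in> V \<Longrightarrow> y v \<in> mpolys W) \<Longrightarrow> mpoly_eval y P \<in> mpolys W"
  by (induction rule: mpolys_induct) auto

text \<open>Each term of \<open>P\<close>, evaluated at \<open>\<psi>\<close>, lies in the
  multiplicative set \<open>M\<close>, and taking a coefficient is additive. A check on single
  elements of \<open>M\<close> therefore covers an unknown polynomial \<open>P\<close>, such as the
  correction terms of a Frobenius lift.\<close>

lemma dvd_lookup_mpoly_eval:
  fixes \<psi> :: "'v \<Rightarrow> 'e::comm_monoid_add \<Rightarrow>\<^sub>0 int"
  assumes "P \<in> mpolys V"
    and 1: "\<And>c. of_int c \<in> M" and mult: "\<And>x y. x \<in> M \<Longrightarrow> y \<in> M \<Longrightarrow> x * y \<in> M"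
    and var: "\<And>v. v \<in> V \<Longrightarrow> \<psi> v \<in> M"
    and dvd: "\<And>x. x \<in> M \<Longrightarrow> d dvd Poly_Mapping.lookup (x * z) e"
  shows "d dvd Poly_Mapping.lookup (mpoly_eval \<psi> P * z) e"
proof -
  have pow: "x ^ k \<in> M" if "x \<in> M" for x k
    using that 1[of 1] by (induction k) (auto intro: mult)
  have "(\<Prod>v\<in>A. \<psi> v ^ m v) \<in> M" if "A \<subseteq> V" for A and m :: "'v \<Rightarrow> nat"
    using that 1[of 1] by (induction A rule: infinite_finite_induct) (auto intro!: mult pow var)
  then have "of_int c * mon_eval \<psi> m \<in> M" if "Poly_Mapping.keys m \<subseteq> V" for c m
    using that by (auto simp: mon_eval_def intro!: mult 1)
  then show ?thesis
    unfolding mpoly_eval_def sum_distrib_right lookup_sum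
    using \<open>P \<in> mpolys V\<close> by (intro dvd_sum dvd) (auto simp: mpolys_iff)
qed

section \<open>Frobenius lifts on hypersurfaces\<close>

text \<open>Presents \<open>S\<close> as a quotient of a polynomial ring, with \<open>N\<close> only
  an upper bound for the kernel. This hides the nested coset types of \<open>hyp_ring\<close> and
  \<open>mod_nat\<close> and turns equations in \<open>S\<close> into membership statements about
  polynomials.\<close>

definition mpoly_presentation ::
  "'v set \<Rightarrow> 'v mpoly set \<Rightarrow> ('a, 'm) ring_scheme \<Rightarrow> ('v mpoly \<Rightarrow> 'a) \<Rightarrow> bool" where
  "mpoly_presentation V N S \<pi> \<longleftrightarrow> cring S \<and> \<pi> \<in> ring_hom (mpoly_ring V) S \<and>
     \<pi> ` mpolys V = carrier S \<and> (\<forall>P \<in> mpolys V. \<pi> P = \<zero>\<^bsub>S\<^esub> \<longrightarrow> P \<in> N)"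

lemma presentation_diff:
  assumes "mpoly_presentation V N S \<pi>" "P \<in> mpolys V" "Q \<in> mpolys V"
  shows "\<pi> (P - Q) = \<pi> P \<ominus>\<^bsub>S\<^esub> \<pi> Q"
proof -
  interpret T: cring "mpoly_ring V" by (rule cring_mpoly_ring)
  interpret S: cring S using assms by (simp add: mpoly_presentation_def)
  interpret h: ring_hom_cring "mpoly_ring V" S \<pi>
    using assms by unfold_locales (simp add: mpoly_presentation_def)
  show ?thesis
    using h.hom_add[of P "- Q"] h.hom_a_inv[of Q] assms
    by (simp add: a_minus_def a_inv_mpoly_ring)
qed

lemma presentation_eqD:
  assumes "mpoly_presentation V N S \<pi>" "P \<in> mpolys V" "Q \<in> mpolys V" "\<pi> P = \<pi> Q"
  shows "P - Q \<in> N"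
proof -
  interpret S: cring S using assms by (simp add: mpoly_presentation_def)
  have "\<pi> Q \<in> carrier S" using assms by (auto simp: mpoly_presentation_def)
  then have "\<pi> (P - Q) = \<zero>\<^bsub>S\<^esub>"
    using presentation_diff[OF assms(1-3)] assms(4) by (simp add: a_minus_def S.r_neg)
  then show ?thesis using assms by (simp add: mpoly_presentation_def)
qed

lemma presentation_nat_elem:
  assumes "mpoly_presentation V N S \<pi>"
  shows "\<pi> (of_nat k) = nat_elem S k"
proof -
  have h: "\<pi> \<in> ring_hom (mpoly_ring V) S" using assms by (simp add: mpoly_presentation_def)
  interpret T: cring "mpoly_ring V" by (rule cring_mpoly_ring)
  interpret S: cring S using assms by (simp add: mpoly_presentation_def)
  interpret h: ring_hom_cring "mpoly_ring V" S \<pi>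
    using h by unfold_locales
  show ?thesis
  proof (induction k)
    case 0
    then show ?case using h.hom_zero by (simp add: nat_elem_def add_pow_def)
  next
    case (Suc k)
    have "\<pi> (of_nat (Suc k)) = \<pi> (of_nat k) \<oplus>\<^bsub>S\<^esub> \<pi> 1"
      using ring_hom_add[OF h, of "of_nat k" 1] by (simp add: add.commute)
    also have "\<pi> 1 = \<one>\<^bsub>S\<^esub>" using ring_hom_one[OF h] by simp
    finally show ?case using Suc by (simp add: nat_elem_def add_pow_def)
  qed
qed

text \<open>In a commutative ring the ideal generated by one element consists of its multiples; the
  multiplier lifts along the surjection \<open>\<pi>\<close>, and the difference of the two sides
  lies in the kernel.\<close>

lemma presentation_genideal:
  assumes pres: "mpoly_presentation V N S \<pi>" and P: "P \<in> mpolys V" and Q: "Q \<in> mpolys V"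
    and mem: "\<pi> P \<in> genideal S {\<pi> Q}"
  shows "\<exists>x\<in>N. \<exists>y\<in>mpolys V. P = x + Q * y"
proof -
  have h: "\<pi> \<in> ring_hom (mpoly_ring V) S" and im: "\<pi> ` mpolys V = carrier S"
    using pres by (auto simp add: mpoly_presentation_def)
  interpret S: cring S using pres by (simp add: mpoly_presentation_def)
  have Qc: "\<pi> Q \<in> carrier S" using Q im by auto
  obtain s where "s \<in> carrier S" "\<pi> P = s \<otimes>\<^bsub>S\<^esub> \<pi> Q"
    using mem S.cgenideal_eq_genideal[OF Qc] by (auto simp: cgenideal_def)
  moreover obtain y where y: "y \<in> mpolys V" "s = \<pi> y" using im \<open>s \<in> carrier S\<close> by auto
  ultimately have "\<pi> P = \<pi> (y * Q)" using ring_hom_mult[OF h] Q by simp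
  then have "P - y * Q \<in> N" by (intro presentation_eqD[OF pres]) (use P Q y in auto)
  then show ?thesis using y by (intro bexI[of _ "P - y * Q"] bexI[of _ y]) (auto simp: mult.commute)
qed

lemma presentation_quotient:
  assumes pres: "mpoly_presentation V N S \<pi>" and Q: "Q \<in> mpolys V"
  shows "mpoly_presentation V {x + Q * y | x y. x \<in> N \<and> y \<in> mpolys V}
           (S Quot genideal S {\<pi> Q}) (\<lambda>P. genideal S {\<pi> Q} +>\<^bsub>S\<^esub> \<pi> P)"
proof -
  have h: "\<pi> \<in> ring_hom (mpoly_ring V) S" and im: "\<pi> ` mpolys V = carrier S"
    using pres by (auto simp add: mpoly_presentation_def)
  interpret S: cring S using pres by (simp add: mpoly_presentation_def)
  define I where "I = genideal S {\<pi> Q}"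
  have Qc: "\<pi> Q \<in> carrier S" using Q im by auto
  interpret I: ideal I S unfolding I_def by (rule S.genideal_ideal) (use Qc in auto)
  have "(\<lambda>P. I +>\<^bsub>S\<^esub> \<pi> P) \<in> ring_hom (mpoly_ring V) (S Quot I)"
    using ring_hom_trans[OF h I.rcos_ring_hom] by (simp add: comp_def)
  moreover have "(\<lambda>P. I +>\<^bsub>S\<^esub> \<pi> P) ` mpolys V = carrier (S Quot I)"
    using im by (force simp: FactRing_simps)
  moreover have "\<exists>x y. P = x + Q * y \<and> x \<in> N \<and> y \<in> mpolys V"
    if P: "P \<in> mpolys V" and "I +>\<^bsub>S\<^esub> \<pi> P = \<zero>\<^bsub>S Quot I\<^esub>" for P
  proof -
    have "I +>\<^bsub>S\<^esub> \<pi> P = I" using that by (simp add: FactRing_def)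
    moreover have "\<pi> P \<in> carrier S" using P im by auto
    ultimately have "\<pi> P \<in> I" using I.a_rcos_self by blast
    then show ?thesis using presentation_genideal[OF pres P Q] unfolding I_def by blast
  qed
  ultimately show ?thesis
    unfolding mpoly_presentation_def I_def[symmetric]
    using I.quotient_is_cring[OF S.is_cring] by auto
qed

text \<open>The second clause records that relations survive: an equation \<open>f\<close> that is
  zero in \<open>S\<close> stays zero after reduction.\<close>

lemma presentation_mod_nat:
  assumes "mpoly_presentation V N S \<pi>"
  shows "\<exists>\<pi>'. mpoly_presentation V {x + of_nat k * y | x y. x \<in> N \<and> y \<in> mpolys V} (mod_nat S k) \<pi>'
           \<and> (\<forall>P. \<pi> P = \<zero>\<^bsub>S\<^esub> \<longrightarrow> \<pi>' P = \<zero>\<^bsub>mod_nat S k\<^esub>)"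
proof -
  interpret S: cring S using assms by (simp add: mpoly_presentation_def)
  let ?I = "genideal S {nat_elem S k}"
  have I: "ideal ?I S"
    by (rule S.genideal_ideal) (simp add: nat_elem_def)
  have "?I +>\<^bsub>S\<^esub> \<zero>\<^bsub>S\<^esub> = \<zero>\<^bsub>mod_nat S k\<^esub>"
    using S.a_rcos_zero[OF I additive_subgroup.zero_closed[OF ideal.axioms(1)[OF I]]]
    by (simp add: mod_nat_def FactRing_def)
  then show ?thesis
    using presentation_quotient[OF assms mpolys_of_nat[of k V]]
    unfolding presentation_nat_elem[OF assms] mod_nat_def
    by (intro exI[of _ "\<lambda>P. ?I +>\<^bsub>S\<^esub> \<pi> P"]) auto
qed

lemma presentation_hyp_ring:
  assumes f: "f \<in> mpolys V"
  shows "\<exists>\<pi>. mpoly_presentation V {f * y | y. y \<in> mpolys V} (hyp_ring V f) \<pi>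
           \<and> \<pi> f = \<zero>\<^bsub>hyp_ring V f\<^esub>"
proof -
  interpret T: cring "mpoly_ring V" by (rule cring_mpoly_ring)
  have "mpoly_presentation V {0} (mpoly_ring V) id"
    unfolding mpoly_presentation_def using T.is_cring by (auto simp: ring_hom_def)
  from presentation_quotient[OF this f]
  have "mpoly_presentation V {f * y | y. y \<in> mpolys V} (hyp_ring V f)
     (\<lambda>P. genideal (mpoly_ring V) {f} +>\<^bsub>mpoly_ring V\<^esub> P)" by (simp add: hyp_ring_def)
  moreover have "genideal (mpoly_ring V) {f} +>\<^bsub>mpoly_ring V\<^esub> f = genideal (mpoly_ring V) {f}"
    using f by (intro T.a_rcos_zero T.genideal_ideal T.genideal_self') auto
  ultimately show ?thesis by (auto simp: hyp_ring_def FactRing_def)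
qed

text \<open>Let polynomials \<open>y v\<close> represent the images of the variables under
  \<open>L\<close>. As \<open>L\<close> is a homomorphism and \<open>f\<close> is zero in
  \<open>S\<close>, the value of \<open>f\<close> at \<open>y\<close> lies in \<open>N\<close>,
  hence in (f, p^2). The lifting condition puts y_v - v^p into (f, p). At \<open>\<psi>\<close> all
  multiples of \<open>f\<close> vanish, which leaves the divisibility by p^2.\<close>

lemma frobenius_lift_evaluation:
  fixes \<psi> :: "'v \<Rightarrow> 'b::comm_ring_1"
  assumes pres: "mpoly_presentation V N S \<pi>"
    and N: "N \<subseteq> {f * x + of_nat (p\<^sup>2) * y | x y. x \<in> mpolys V \<and> y \<in> mpolys V}"
    and f: "f \<in> mpolys V" "\<pi> f = \<zero>\<^bsub>S\<^esub>"
    and L: "is_frobenius_lift S p L"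
    and \<psi>: "mpoly_eval \<psi> f = 0"
  shows "\<exists>g. (\<forall>v. g v \<in> mpolys V) \<and>
           of_nat (p\<^sup>2) dvd mpoly_eval (\<lambda>v. \<psi> v ^ p + of_nat p * mpoly_eval \<psi> (g v)) f"
proof -
  have h: "\<pi> \<in> ring_hom (mpoly_ring V) S" and im: "\<pi> ` mpolys V = carrier S"
    using pres by (auto simp add: mpoly_presentation_def)
  have \<pi>c: "\<pi> P \<in> carrier S" if "P \<in> mpolys V" for P using im that by auto
  interpret T: cring "mpoly_ring V" by (rule cring_mpoly_ring)
  interpret S: cring S using pres by (simp add: mpoly_presentation_def)
  interpret h: ring_hom_cring "mpoly_ring V" S \<pi>
    using h by unfold_locales
  have LS: "L \<in> ring_hom S S" using L by (simp add: is_frobenius_lift_def)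
  interpret L: ring_hom_cring S S L using LS by unfold_locales
  have "\<forall>v\<in>V. \<exists>y\<in>mpolys V. \<pi> y = L (\<pi> (Var v))"
  proof
    fix v assume "v \<in> V"
    then have "L (\<pi> (Var v)) \<in> carrier S" using ring_hom_closed[OF LS] \<pi>c by simp
    then show "\<exists>y\<in>mpolys V. \<pi> y = L (\<pi> (Var v))" using im by (metis imageE)
  qed
  then obtain y where y: "\<And>v. v \<in> V \<Longrightarrow> y v \<in> mpolys V \<and> \<pi> (y v) = L (\<pi> (Var v))"
    by metis
  have yP: "mpoly_eval y P \<in> mpolys V" if "P \<in> mpolys V" for P
    using mpoly_eval_mpolys that y by metis
  \<comment> \<open>Both sides are compatible with the ring operations in \<open>P\<close> and agree
    on the variables.\<close>
  have "\<pi> (mpoly_eval y P) = L (\<pi> P)" if "P \<in> mpolys V" for P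
    using that
  proof (induction rule: mpolys_induct)
    case one
    then show ?case using ring_hom_one[OF h] ring_hom_one[OF LS] by simp
  next
    case (var v)
    then show ?case using y by simp
  next
    case (add A B)
    then show ?case
      using ring_hom_add[OF h] ring_hom_add[OF LS] yP \<pi>c by simp
  next
    case (uminus A)
    then show ?case
      using h.hom_a_inv[of A] h.hom_a_inv[of "mpoly_eval y A"] L.hom_a_inv[of "\<pi> A"] yP \<pi>c
      by (simp add: a_inv_mpoly_ring)
  next
    case (mult A B)
    then show ?case
      using ring_hom_mult[OF h] ring_hom_mult[OF LS] yP \<pi>c by simp
  qed
  from this[OF f(1)] have "\<pi> (mpoly_eval y f) = \<pi> 0" using f h.hom_zero L.hom_zero by simp
  then have "mpoly_eval y f - 0 \<in> N"
    by (intro presentation_eqD[OF pres]) (use f yP in auto)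
  then obtain a b where ab: "mpoly_eval y f = f * a + of_nat (p\<^sup>2) * b" using N by auto
  have "\<exists>g\<in>mpolys V. mpoly_eval \<psi> (y v) = \<psi> v ^ p + of_nat p * mpoly_eval \<psi> g" if v: "v \<in> V" for v
  proof -
    have "\<pi> (Var v ^ p) = \<pi> (Var v) [^]\<^bsub>S\<^esub> p"
      using ring_hom_ring.hom_nat_pow[OF ring_hom_ringI2[OF T.ring_axioms S.ring_axioms h], of "Var v" p] v by (simp add: nat_pow_mpoly_ring)
    then have "\<pi> (y v - Var v ^ p) = L (\<pi> (Var v)) \<ominus>\<^bsub>S\<^esub> \<pi> (Var v) [^]\<^bsub>S\<^esub> p"
      using presentation_diff[OF pres] y v by simp
    also have "\<dots> \<in> genideal S {\<pi> (of_nat p)}"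
      using L \<pi>c v unfolding presentation_nat_elem[OF pres] by (simp add: is_frobenius_lift_def)
    finally obtain x z where x: "x \<in> N" and z: "z \<in> mpolys V" "y v - Var v ^ p = x + of_nat p * z"
      using presentation_genideal[OF pres, of "y v - Var v ^ p" "of_nat p"] y v by auto
    obtain a' b' where x': "x = f * a' + of_nat (p\<^sup>2) * b'" "b' \<in> mpolys V" using x N by auto
    \<comment> \<open>The p^2 part of \<open>x\<close> is absorbed into the multiple of p, and the
      multiple of \<open>f\<close> is killed by \<open>\<psi>\<close>.\<close>
    have "y v = Var v ^ p + f * a' + of_nat p * (of_nat p * b' + z)"
      using z x' by (simp add: algebra_simps power2_eq_square)
    then have "mpoly_eval \<psi> (y v) = \<psi> v ^ p + of_nat p * mpoly_eval \<psi> (of_nat p * b' + z)"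
      using \<psi> by simp
    then show ?thesis using z x' by (intro bexI[of _ "of_nat p * b' + z"]) auto
  qed
  then obtain g where g: "\<And>v. v \<in> V \<Longrightarrow> g v \<in> mpolys V"
      "\<And>v. v \<in> V \<Longrightarrow> mpoly_eval \<psi> (y v) = \<psi> v ^ p + of_nat p * mpoly_eval \<psi> (g v)" by metis
  \<comment> \<open>The value 0 outside \<open>V\<close> makes every \<open>g' v\<close> a
    polynomial in \<open>V\<close>; evaluating \<open>f\<close> only reads the values on
    \<open>V\<close>.\<close>
  define g' where "g' v = (if v \<in> V then g v else 0)" for v
  have "mpoly_eval (\<lambda>v. \<psi> v ^ p + of_nat p * mpoly_eval \<psi> (g' v)) f
      = mpoly_eval (\<lambda>v. mpoly_eval \<psi> (y v)) f"
    by (rule mpoly_eval_cong[OF f(1)]) (simp add: g'_def g)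
  also have "\<dots> = of_nat (p\<^sup>2) * mpoly_eval \<psi> b"
    using ab \<psi> by (simp flip: mpoly_eval_mpoly_eval)
  finally show ?thesis using g by (intro exI[of _ g']) (auto simp: g'_def)
qed

text \<open>Lifts on the hypersurface ring and on its reduction modulo p^2 are treated alike: the
  kernels of the two presentations are bounded by (f) and (f, p^2), and both bounds lie in (f,
  p^2).\<close>

lemma hyp_ring_lift_evaluation:
  fixes \<psi> :: "'v \<Rightarrow> 'b::comm_ring_1"
  assumes f: "f \<in> mpolys V"
    and lifts: "frob_lifts_mod_p2 (hyp_ring V f) p \<or> frob_lifts (hyp_ring V f) p"
    and \<psi>: "mpoly_eval \<psi> f = 0"
  obtains g where "\<And>v. g v \<in> mpolys V"
    "of_nat (p\<^sup>2) dvd mpoly_eval (\<lambda>v. \<psi> v ^ p + of_nat p * mpoly_eval \<psi> (g v)) f"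
proof -
  obtain \<pi> where \<pi>: "mpoly_presentation V {f * y | y. y \<in> mpolys V} (hyp_ring V f) \<pi>"
      "\<pi> f = \<zero>\<^bsub>hyp_ring V f\<^esub>"
    using presentation_hyp_ring[OF f] by auto
  have "\<exists>g. (\<forall>v. g v \<in> mpolys V) \<and>
      of_nat (p\<^sup>2) dvd mpoly_eval (\<lambda>v. \<psi> v ^ p + of_nat p * mpoly_eval \<psi> (g v)) f"
    using lifts
  proof
    assume "frob_lifts (hyp_ring V f) p"
    then obtain L where L: "is_frobenius_lift (hyp_ring V f) p L" by (auto simp: frob_lifts_def)
    show ?thesis
      by (rule frobenius_lift_evaluation[OF \<pi>(1) _ f \<pi>(2) L \<psi>]) (force intro: exI[of _ 0])
  next
    assume "frob_lifts_mod_p2 (hyp_ring V f) p"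
    then obtain L where L: "is_frobenius_lift (mod_nat (hyp_ring V f) (p\<^sup>2)) p L"
      by (auto simp: frob_lifts_mod_p2_def)
    define N where "N = {f * y | y. y \<in> mpolys V}"
    obtain \<pi>' where \<pi>': "mpoly_presentation V {x + of_nat (p\<^sup>2) * y | x y. x \<in> N \<and> y \<in> mpolys V}
        (mod_nat (hyp_ring V f) (p\<^sup>2)) \<pi>'"
        "\<forall>P. \<pi> P = \<zero>\<^bsub>hyp_ring V f\<^esub> \<longrightarrow> \<pi>' P = \<zero>\<^bsub>mod_nat (hyp_ring V f) (p\<^sup>2)\<^esub>"
      using presentation_mod_nat[OF \<pi>(1)[folded N_def], of "p\<^sup>2"] by (elim exE conjE)
    show ?thesis
    proof (rule frobenius_lift_evaluation[OF \<pi>'(1) _ f _ L \<psi>])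
      show "\<pi>' f = \<zero>\<^bsub>mod_nat (hyp_ring V f) (p\<^sup>2)\<^esub>" using \<pi>' \<pi>(2) by blast
      show "{x + of_nat (p\<^sup>2) * y | x y. x \<in> N \<and> y \<in> mpolys V}
          \<subseteq> {f * x + of_nat (p\<^sup>2) * y | x y. x \<in> mpolys V \<and> y \<in> mpolys V}"
        unfolding N_def by blast
    qed
  qed
  then show thesis using that by blast
qed

section \<open>Determinants and Pfaffians of bordered matrices\<close>

lemma mpoly_eval_det_n: "mpoly_eval \<psi> (det_n n A) = det_n n (\<lambda>i j. mpoly_eval \<psi> (A i j))"
  by (simp add: det_n_def)

lemma mpoly_eval_pfaffian: "mpoly_eval \<psi> (pfaffian n A) = pfaffian n (\<lambda>i j. mpoly_eval \<psi> (A i j))"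
  by (simp add: pfaffian_def)

lemma det_n_mpolys:
  assumes "\<And>i j. i < n \<Longrightarrow> j < n \<Longrightarrow> A i j \<in> mpolys V"
  shows "det_n n A \<in> mpolys V"
  unfolding det_n_def
  by (intro mpolys_sum mpolys_mult mpolys_prod assms mpolys_of_int)
     (auto dest: permutes_in_image)

lemma pfaffian_mpolys:
  assumes "\<And>i j. i < n \<Longrightarrow> j < n \<Longrightarrow> A i j \<in> mpolys V"
  shows "pfaffian n A \<in> mpolys V"
proof -
  have "\<sigma> (2 * i) < n" "\<sigma> (2 * i + 1) < n" if "\<sigma> permutes {..<n}" "i < n div 2" for \<sigma> i
    using permutes_in_image[OF that(1), of "2 * i"] permutes_in_image[OF that(1), of "2 * i + 1"] that(2)
    by auto
  then show ?thesis
    unfolding pfaffian_def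
    by (intro mpolys_sum mpolys_mult mpolys_prod assms mpolys_of_int) auto
qed

section \<open>Removing the border of a determinant modulo a square\<close>

lemma square_dvd_prod:
  fixes f :: "'a \<Rightarrow> 'b::comm_ring_1"
  assumes "finite A" "i \<in> A" "j \<in> A" "i \<noteq> j" "q dvd f i" "q dvd f j"
  shows "q\<^sup>2 dvd prod f A"
proof -
  have "prod f A = f i * (f j * prod f (A - {i} - {j}))"
    using assms by (simp add: prod.remove[of A i] prod.remove[of "A - {i}" j])
  moreover have "q * q dvd f i * f j" using assms by (intro mult_dvd_mono)
  ultimately show ?thesis by (simp add: power2_eq_square mult.assoc[symmetric] dvd_mult2)
qed

lemma permutes_lessThan_Suc_fix:
  "{\<sigma>. \<sigma> permutes {..<Suc n} \<and> \<sigma> n = n} = {\<sigma>. \<sigma> permutes {..<n}}"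
proof (intro equalityI subsetI; clarsimp)
  fix \<sigma> assume *: "\<sigma> permutes {..<Suc n}" "\<sigma> n = n"
  show "\<sigma> permutes {..<n}"
    by (rule permutes_superset[OF *(1)]) (use * in \<open>auto simp: less_Suc_eq\<close>)
next
  fix \<sigma> assume "\<sigma> permutes {..<n}"
  then show "\<sigma> permutes {..<Suc n} \<and> \<sigma> n = n"
    using permutes_subset[of \<sigma> "{..<n}" "{..<Suc n}"] permutes_not_in[of \<sigma> "{..<n}" n] by auto
qed

text \<open>A permutation that moves \<open>n\<close> picks one entry of column \<open>n\<close> and
  another one of row \<open>n\<close>, both divisible by \<open>q\<close>. The permutations fixing
  \<open>n\<close> contribute exactly the product with the smaller determinant.\<close>

lemma det_n_Suc_square_dvd:
  fixes Y :: "nat \<Rightarrow> nat \<Rightarrow> 'a::comm_ring_1"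
  assumes col: "\<And>i. i < n \<Longrightarrow> q dvd Y i n" and row: "\<And>j. j < n \<Longrightarrow> q dvd Y n j"
  shows "q\<^sup>2 dvd det_n (Suc n) Y - Y n n * det_n n Y"
proof -
  define t where "t \<sigma> = of_int (sign \<sigma>) * (\<Prod>i<Suc n. Y i (\<sigma> i))" for \<sigma> :: "nat \<Rightarrow> nat"
  let ?P = "{\<sigma>. \<sigma> permutes {..<Suc n}}"
  let ?F = "{\<sigma>. \<sigma> permutes {..<Suc n} \<and> \<sigma> n = n}"
  have fin: "finite ?P" by (simp add: finite_permutations)
  have "det_n (Suc n) Y = sum t ?F + sum t (?P - ?F)"
    unfolding det_n_def t_def[symmetric] using fin by (subst sum.subset_diff[of ?F]) (auto simp: add.commute)
  moreover have "sum t ?F = Y n n * det_n n Y"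
    unfolding permutes_lessThan_Suc_fix det_n_def sum_distrib_left t_def
    by (intro sum.cong refl) (simp add: permutes_not_in mult_ac)
  moreover have "q\<^sup>2 dvd t \<sigma>" if "\<sigma> \<in> ?P - ?F" for \<sigma>
  proof -
    have \<sigma>: "\<sigma> permutes {..<Suc n}" "\<sigma> n \<noteq> n" using that by auto
    obtain i where i: "\<sigma> i = n" using permutes_surj[OF \<sigma>(1)] by (metis surjD)
    have "i < Suc n" using i permutes_not_in[OF \<sigma>(1), of i] by (metis lessI lessThan_iff)
    then have i': "i < n" using i \<sigma>(2) by (metis less_Suc_eq)
    have "\<sigma> n < n" using permutes_in_image[OF \<sigma>(1), of n] \<sigma>(2) by simp
    then have "q\<^sup>2 dvd (\<Prod>i<Suc n. Y i (\<sigma> i))"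
      by (intro square_dvd_prod[of _ i n]) (use i i' col row in auto)
    then show ?thesis unfolding t_def by (rule dvd_mult)
  qed
  then have "q\<^sup>2 dvd sum t (?P - ?F)" by (rule dvd_sum)
  ultimately show ?thesis by simp
qed

text \<open>Writing u = 1 + q g, the element 1 - q g is an inverse of \<open>u\<close> modulo
  q^2.\<close>

lemma square_dvd_unit_cancel:
  fixes q :: "'a::comm_ring_1"
  assumes "q dvd u - 1" "q\<^sup>2 dvd u * d"
  shows "q\<^sup>2 dvd d"
proof -
  obtain g where "u = 1 + q * g" using assms(1) by (metis add.commute diff_add_cancel dvdE)
  then have "d = (1 - q * g) * (u * d) + q\<^sup>2 * (g\<^sup>2 * d)"
    by (simp add: algebra_simps power2_eq_square)
  then show ?thesis using assms(2) by (metis dvd_add dvd_mult dvd_triv_left)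
qed

text \<open>The last row and column are peeled off repeatedly, and the diagonal entry is cancelled
  as a unit modulo q^2. The border has to match the identity only modulo \<open>q\<close>, so
  arbitrary corrections by multiples of \<open>q\<close> are allowed there.\<close>

lemma square_dvd_det_n_reduce:
  fixes Y :: "nat \<Rightarrow> nat \<Rightarrow> 'a::comm_ring_1"
  assumes "m \<le> n" "q\<^sup>2 dvd det_n n Y"
    and "\<And>i j. m \<le> max i j \<Longrightarrow> q dvd Y i j - (if i = j then 1 else 0)"
  shows "q\<^sup>2 dvd det_n m Y"
  using assms(1,2)
proof (induction n rule: dec_induct)
  case base
  then show ?case .
next
  case (step n)
  have "q dvd Y i n" "q dvd Y n i" if "i < n" for i
    using assms(3)[of i n] assms(3)[of n i] that step(1) by auto
  then have "q\<^sup>2 dvd det_n (Suc n) Y - Y n n * det_n n Y"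
    by (intro det_n_Suc_square_dvd) auto
  then have "q\<^sup>2 dvd Y n n * det_n n Y"
    using dvd_diff[OF step(4)] by fastforce
  moreover have "q dvd Y n n - 1" using assms(3)[of n n] step(1) by simp
  ultimately show ?case by (intro step(3)) (rule square_dvd_unit_cancel)
qed

section \<open>Removing the border of a Pfaffian modulo a square\<close>

definition pf_perms :: "nat \<Rightarrow> (nat \<Rightarrow> nat) set" where
  "pf_perms n = {\<sigma>. \<sigma> permutes {..<n}
        \<and> (\<forall>i < n div 2. \<sigma> (2*i) < \<sigma> (2*i+1))
        \<and> (\<forall>i. Suc i < n div 2 \<longrightarrow> \<sigma> (2*i) < \<sigma> (2*(Suc i)))}"

text \<open>If \<open>2*k\<close> is the smaller member of a pair, its partner is
  \<open>2*k+1\<close>, the only larger index. A later pair would have to begin with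
  \<open>2*k+1\<close> and would find no larger partner, so this pair is the last one.\<close>

lemma pf_perms_last:
  assumes \<sigma>: "\<sigma> \<in> pf_perms (Suc (Suc (2*k)))" and i: "i \<le> k" "\<sigma> (2*i) = 2*k"
  shows "\<sigma> (2*k) = 2*k \<and> \<sigma> (Suc (2*k)) = Suc (2*k)"
proof -
  have perm: "\<sigma> permutes {..<Suc (Suc (2*k))}"
    and lt: "\<And>i. i \<le> k \<Longrightarrow> \<sigma> (2*i) < \<sigma> (2*i+1)"
    and inc: "\<And>i. i < k \<Longrightarrow> \<sigma> (2*i) < \<sigma> (2*(Suc i))"
    using \<sigma> by (auto simp: pf_perms_def)
  have bound: "\<sigma> j < Suc (Suc (2*k))" if "j < Suc (Suc (2*k))" for j
    using permutes_in_image[OF perm, of j] that by auto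
  have "\<sigma> (2*i+1) = Suc (2*k)" using lt[of i] bound[of "2*i+1"] i by auto
  moreover have "i = k"
  proof (rule ccontr)
    assume "i \<noteq> k"
    then have "\<sigma> (2*i) < \<sigma> (2*(Suc i))" "\<sigma> (2 * Suc i) < \<sigma> (2 * Suc i + 1)"
      using inc[of i] lt[of "Suc i"] i by auto
    then show False using bound[of "2 * Suc i + 1"] i \<open>i \<noteq> k\<close> by auto
  qed
  ultimately show ?thesis using i by simp
qed

lemma pf_perms_fix:
  "{\<sigma> \<in> pf_perms (Suc (Suc (2*k))). \<sigma> (2*k) = 2*k \<and> \<sigma> (Suc (2*k)) = Suc (2*k)} = pf_perms (2*k)"
  (is "?L = ?R")
proof (intro equalityI subsetI)
  fix \<sigma> assume s: "\<sigma> \<in> ?L"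
  then have "\<sigma> permutes {..<Suc (Suc (2*k))}" by (auto simp: pf_perms_def)
  then have "\<sigma> permutes {..<Suc (2*k)}" using s permutes_lessThan_Suc_fix[of "Suc (2*k)"] by auto
  then have "\<sigma> permutes {..<2*k}" using s permutes_lessThan_Suc_fix[of "2*k"] by auto
  with s show "\<sigma> \<in> ?R" by (auto simp: pf_perms_def)
next
  fix \<sigma> assume s: "\<sigma> \<in> ?R"
  then have p: "\<sigma> permutes {..<2*k}" by (auto simp: pf_perms_def)
  have fixed: "\<sigma> (2*k) = 2*k" "\<sigma> (Suc (2*k)) = Suc (2*k)" using permutes_not_in[OF p] by auto
  have bound: "\<sigma> j < 2*k" if "j < 2*k" for j
    using permutes_in_image[OF p, of j] that by auto
  have "\<sigma> permutes {..<Suc (Suc (2*k))}" by (rule permutes_subset[OF p]) auto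
  moreover have "\<sigma> (2*i) < \<sigma> (2*i+1)" if "i < Suc k" for i
    using s that fixed by (cases "i = k") (auto simp: pf_perms_def)
  moreover have "\<sigma> (2*i) < \<sigma> (2*Suc i)" if "Suc i < Suc k" for i
    using s that fixed bound[of "2*i"] by (cases "Suc i = k") (auto simp: pf_perms_def)
  ultimately show "\<sigma> \<in> ?L" using fixed by (auto simp: pf_perms_def)
qed

text \<open>A matching that does not pair \<open>2*k\<close> with \<open>2*k+1\<close> joins each of
  them to a smaller index, so its term contains two factors from the last two columns, both
  divisible by \<open>q\<close>.\<close>

lemma pfaffian_Suc_Suc_square_dvd:
  fixes Y :: "nat \<Rightarrow> nat \<Rightarrow> 'a::comm_ring_1"
  assumes col: "\<And>i. i < 2*k \<Longrightarrow> q dvd Y i (2*k)" "\<And>i. i < 2*k \<Longrightarrow> q dvd Y i (Suc (2*k))"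
  shows "q\<^sup>2 dvd pfaffian (Suc (Suc (2*k))) Y - Y (2*k) (Suc (2*k)) * pfaffian (2*k) Y"
proof -
  define t where "t \<sigma> = of_int (sign \<sigma>) * (\<Prod>i<Suc k. Y (\<sigma> (2*i)) (\<sigma> (2*i+1)))" for \<sigma> :: "nat \<Rightarrow> nat"
  let ?P = "pf_perms (Suc (Suc (2*k)))"
  let ?F = "{\<sigma> \<in> ?P. \<sigma> (2*k) = 2*k \<and> \<sigma> (Suc (2*k)) = Suc (2*k)}"
  have fin: "finite ?P"
    unfolding pf_perms_def by (rule finite_subset[OF _ finite_permutations[of "{..<Suc (Suc (2*k))}"]]) auto
  have "pfaffian (Suc (Suc (2*k))) Y = sum t ?P"
  proof -
    have "Suc (Suc (2*k)) div 2 = Suc k" by simp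
    then show ?thesis unfolding pfaffian_def pf_perms_def t_def by (simp only:)
  qed
  then have "pfaffian (Suc (Suc (2*k))) Y = sum t ?F + sum t (?P - ?F)"
    using fin by (subst (asm) sum.subset_diff[of ?F]) (auto simp: add.commute)
  moreover have "sum t ?F = Y (2*k) (Suc (2*k)) * pfaffian (2*k) Y"
  proof -
    have "sum t ?F = (\<Sum>\<sigma>\<in>pf_perms (2*k). Y (2*k) (Suc (2*k)) * (of_int (sign \<sigma>) * (\<Prod>i<k. Y (\<sigma> (2*i)) (\<sigma> (2*i+1)))))"
    proof (rule sum.cong[OF pf_perms_fix])
      fix \<sigma> assume "\<sigma> \<in> pf_perms (2*k)"
      then have "\<sigma> (2*k) = 2*k" "\<sigma> (Suc (2*k)) = Suc (2*k)"
        by (simp_all flip: pf_perms_fix)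
      then show "t \<sigma> = Y (2*k) (Suc (2*k)) * (of_int (sign \<sigma>) * (\<Prod>i<k. Y (\<sigma> (2*i)) (\<sigma> (2*i+1))))"
        by (simp add: t_def mult.left_commute mult.commute)
    qed
    then show ?thesis by (simp add: pfaffian_def pf_perms_def sum_distrib_left)
  qed
  moreover have "q\<^sup>2 dvd t \<sigma>" if "\<sigma> \<in> ?P - ?F" for \<sigma>
  proof -
    have \<sigma>: "\<sigma> \<in> ?P" "\<sigma> \<notin> ?F" using that by auto
    have perm: "\<sigma> permutes {..<Suc (Suc (2*k))}"
      and lt: "\<And>i. i \<le> k \<Longrightarrow> \<sigma> (2*i) < \<sigma> (2*i+1)"
      using \<sigma> by (auto simp: pf_perms_def)
    have bound: "\<sigma> j < Suc (Suc (2*k))" if "j < Suc (Suc (2*k))" for j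
      using permutes_in_image[OF perm, of j] that by auto
    have no: "\<sigma> (2*i) \<noteq> 2*k" if "i \<le> k" for i using pf_perms_last[OF \<sigma>(1) that] \<sigma> by auto
    have pre: "\<exists>j<Suc (Suc (2*k)). \<sigma> j = x" if "x < Suc (Suc (2*k))" for x
      using permutes_surj[OF perm] permutes_in_image[OF perm] that by (metis lessThan_iff surjD)
    \<comment> \<open>Both top indices are larger members of their pairs: \<open>no\<close> excludes
      \<open>2*k\<close> as a smaller member, and nothing lies above \<open>2*k+1\<close>.\<close>
    have odd: "\<exists>i\<le>k. \<sigma> (2*i+1) = x \<and> \<sigma> (2*i) < 2*k" if x: "x = 2*k \<or> x = Suc (2*k)" for x
    proof -
      obtain j where j: "j < Suc (Suc (2*k))" "\<sigma> j = x" using pre[of x] x by auto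
      have "odd j"
      proof
        assume "even j"
        then obtain i where i: "j = 2*i" by blast
        then have "i \<le> k" using j by simp
        then have "\<sigma> (2*i) = Suc (2*k)" using no[of i] j i x by auto
        then show False using lt[of i] bound[of "2*i+1"] \<open>i \<le> k\<close> by auto
      qed
      then obtain i where i: "j = 2*i+1" by (metis oddE)
      then have "i \<le> k" using j by simp
      moreover have "\<sigma> (2*i) < 2*k" using lt[of i] no[of i] i j x \<open>i \<le> k\<close> by auto
      ultimately show ?thesis using i j by (intro exI[of _ i]) simp
    qed
    obtain a where a: "a \<le> k" "\<sigma> (2*a+1) = 2*k" "\<sigma> (2*a) < 2*k" using odd by blast
    obtain b where b: "b \<le> k" "\<sigma> (2*b+1) = Suc (2*k)" "\<sigma> (2*b) < 2*k" using odd by blast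
    have "q\<^sup>2 dvd (\<Prod>i<Suc k. Y (\<sigma> (2*i)) (\<sigma> (2*i+1)))"
    proof (rule square_dvd_prod[of _ a b])
      show "a \<noteq> b" using a b by auto
      show "q dvd Y (\<sigma> (2*a)) (\<sigma> (2*a+1))" unfolding a(2) by (rule col(1)[OF a(3)])
      show "q dvd Y (\<sigma> (2*b)) (\<sigma> (2*b+1))" unfolding b(2) by (rule col(2)[OF b(3)])
    qed (use a b in auto)
    then show ?thesis unfolding t_def by (rule dvd_mult)
  qed
  then have "q\<^sup>2 dvd sum t (?P - ?F)" by (rule dvd_sum)
  ultimately show ?thesis by simp
qed

text \<open>Two columns are removed at a time, the standard symplectic block taking the place of the
  diagonal entry 1.\<close>

lemma square_dvd_pfaffian_reduce:
  fixes Y :: "nat \<Rightarrow> nat \<Rightarrow> 'a::comm_ring_1"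
  assumes "m \<le> k" "q\<^sup>2 dvd pfaffian (2*k) Y"
    and "\<And>i j. i < j \<Longrightarrow> 2*m \<le> j \<Longrightarrow> q dvd Y i j - (if even i \<and> j = Suc i then 1 else 0)"
  shows "q\<^sup>2 dvd pfaffian (2*m) Y"
  using assms(1,2)
proof (induction k rule: dec_induct)
  case base
  then show ?case .
next
  case (step k)
  have "q dvd Y i (2*k)" "q dvd Y i (Suc (2*k))" if "i < 2*k" for i
  proof -
    \<comment> \<open>By parity \<open>2*k\<close> never closes a standard block, so its column is 0
      modulo \<open>q\<close> above the diagonal.\<close>
    have "\<not> (even i \<and> 2*k = Suc i)" by presburger
    then show "q dvd Y i (2*k)" "q dvd Y i (Suc (2*k))"
      using assms(3)[of i "2*k"] assms(3)[of i "Suc (2*k)"] that step(1) by (simp_all split: if_splits)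
  qed
  then have "q\<^sup>2 dvd pfaffian (Suc (Suc (2*k))) Y - Y (2*k) (Suc (2*k)) * pfaffian (2*k) Y"
    by (intro pfaffian_Suc_Suc_square_dvd) auto
  then have "q\<^sup>2 dvd Y (2*k) (Suc (2*k)) * pfaffian (2*k) Y"
    using step(4) dvd_diff[of "q\<^sup>2" "pfaffian (Suc (Suc (2*k))) Y"] by fastforce
  moreover have "q dvd Y (2*k) (Suc (2*k)) - 1"
    using assms(3)[of "2*k" "Suc (2*k)"] step(1) by simp
  ultimately show ?case by (intro step(3)) (rule square_dvd_unit_cancel)
qed

section \<open>Small determinants and Pfaffians, and exact removal of borders\<close>

lemma det_n_3:
  "det_n 3 A = A 0 0 * A 1 1 * A 2 2 + A 0 1 * A 1 2 * A 2 0 + A 0 2 * A 1 0 * A 2 1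
     - A 0 0 * A 1 2 * A 2 1 - A 0 1 * A 1 0 * A 2 2 - A 0 2 * A 1 1 * A 2 0"
proof -
  have e: "{..<3::nat} = {0,1,2}" by auto
  show ?thesis
    unfolding det_n_def e
    by (simp add: sum_over_permutations_insert permutes_sing sign_compose sign_swap_id
        permutation_swap_id permutation_compose transpose_def algebra_simps)
qed

lemma det_n_4:
  "det_n 4 A =
     A 0 0 * A 1 1 * A 2 2 * A 3 3 - A 0 0 * A 1 1 * A 2 3 * A 3 2
   - A 0 0 * A 1 2 * A 2 1 * A 3 3 + A 0 0 * A 1 2 * A 2 3 * A 3 1
   + A 0 0 * A 1 3 * A 2 1 * A 3 2 - A 0 0 * A 1 3 * A 2 2 * A 3 1
   - A 0 1 * A 1 0 * A 2 2 * A 3 3 + A 0 1 * A 1 0 * A 2 3 * A 3 2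
   + A 0 1 * A 1 2 * A 2 0 * A 3 3 - A 0 1 * A 1 2 * A 2 3 * A 3 0
   - A 0 1 * A 1 3 * A 2 0 * A 3 2 + A 0 1 * A 1 3 * A 2 2 * A 3 0
   + A 0 2 * A 1 0 * A 2 1 * A 3 3 - A 0 2 * A 1 0 * A 2 3 * A 3 1
   - A 0 2 * A 1 1 * A 2 0 * A 3 3 + A 0 2 * A 1 1 * A 2 3 * A 3 0
   + A 0 2 * A 1 3 * A 2 0 * A 3 1 - A 0 2 * A 1 3 * A 2 1 * A 3 0
   - A 0 3 * A 1 0 * A 2 1 * A 3 2 + A 0 3 * A 1 0 * A 2 2 * A 3 1
   + A 0 3 * A 1 1 * A 2 0 * A 3 2 - A 0 3 * A 1 1 * A 2 2 * A 3 0
   - A 0 3 * A 1 2 * A 2 0 * A 3 1 + A 0 3 * A 1 2 * A 2 1 * A 3 0"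
proof -
  have e: "{..<4::nat} = {0,1,2,3}" by auto
  show ?thesis
    unfolding det_n_def e
    by (simp add: sum_over_permutations_insert permutes_sing sign_compose sign_swap_id
        permutation_swap_id permutation_compose transpose_def algebra_simps)
qed

lemma pfaffian_4:
  "pfaffian 4 A = A 0 1 * A 2 3 - A 0 2 * A 1 3 + A 0 3 * A 1 2"
proof -
  have e: "{..<4::nat} = {0,1,2,3}" by auto
  have all: "(\<forall>i<4 div 2. P i) \<longleftrightarrow> P 0 \<and> P 1" "(\<forall>i. Suc i < 4 div 2 \<longrightarrow> P i) \<longleftrightarrow> P 0" for P :: "nat \<Rightarrow> bool"
    by (auto simp: less_2_cases_iff)
  have prod: "(\<Prod>i<4 div 2. f i) = f 0 * f 1" for f :: "nat \<Rightarrow> 'a"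
  proof -
    have "{..<4 div 2} = {0, 1::nat}" by auto
    then show ?thesis by simp
  qed
  have fin: "finite {\<sigma>. \<sigma> permutes {0,1,2,3::nat}}" by (rule finite_permutations) simp
  show ?thesis
    unfolding pfaffian_def all prod e Collect_conj_eq
    \<comment> \<open>The ordering conditions become a conditional summand, so that all 24
      permutations can be enumerated; three of them survive.\<close>
    unfolding sum.inter_restrict[OF fin] mem_Collect_eq Int_iff
    by (simp add: sum_over_permutations_insert permutes_sing sign_compose sign_swap_id
        permutation_swap_id permutation_compose transpose_def algebra_simps)
       (simp add: numeral_2_eq_2 numeral_3_eq_3 add.commute)
qed

lemma det_n_block_identity:
  fixes Y :: "nat \<Rightarrow> nat \<Rightarrow> 'a::comm_ring_1"
  assumes "m \<le> n" and Y: "\<And>i j. m \<le> max i j \<Longrightarrow> Y i j = (if i = j then 1 else 0)"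
  shows "det_n n Y = det_n m Y"
  using assms(1)
proof (induction n rule: dec_induct)
  case (step n)
  \<comment> \<open>The congruence with \<open>q = 0\<close> is an equality, since 0 divides only
    0.\<close>
  have "0\<^sup>2 dvd det_n (Suc n) Y - Y n n * det_n n Y"
    using step(1) Y by (intro det_n_Suc_square_dvd) auto
  then show ?case using Y[of n n] step by simp
qed simp

lemma pfaffian_block_standard:
  fixes Y :: "nat \<Rightarrow> nat \<Rightarrow> 'a::comm_ring_1"
  assumes "m \<le> k"
    and Y: "\<And>i j. i < j \<Longrightarrow> 2*m \<le> j \<Longrightarrow> Y i j = (if even i \<and> j = Suc i then 1 else 0)"
  shows "pfaffian (2*k) Y = pfaffian (2*m) Y"
  using assms(1)
proof (induction k rule: dec_induct)
  case (step k)
  have "Y i (2*k) = 0" "Y i (Suc (2*k)) = 0" if "i < 2*k" for i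
  proof -
    have "\<not> (even i \<and> 2*k = Suc i)" by presburger
    then show "Y i (2*k) = 0" "Y i (Suc (2*k)) = 0"
      using Y[of i "2*k"] Y[of i "Suc (2*k)"] that step(1) by simp_all
  qed
  \<comment> \<open>Again the case \<open>q = 0\<close>, where divisibility means equality.\<close>
  then have "0\<^sup>2 dvd pfaffian (Suc (Suc (2*k))) Y - Y (2*k) (Suc (2*k)) * pfaffian (2*k) Y"
    by (intro pfaffian_Suc_Suc_square_dvd) auto
  then show ?case using Y[of "2*k" "Suc (2*k)"] step by simp
qed simp

section \<open>First-order expansion modulo p^2 and its coefficients\<close>

lemma prod_first_order:
  fixes b g :: "'i \<Rightarrow> 'a::comm_ring_1"
  assumes "finite A"
  shows "q\<^sup>2 dvd (\<Prod>i\<in>A. b i + q * g i) - (prod b A + q * (\<Sum>k\<in>A. g k * prod b (A - {k})))"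
  using assms
proof (induction A rule: finite_induct)
  case (insert x A)
  define P where "P = (\<Prod>i\<in>A. b i + q * g i)"
  define s where "s = (\<Sum>k\<in>A. g k * prod b (A - {k}))"
  obtain r where r: "P = prod b A + q * s + q\<^sup>2 * r"
    using insert by (auto simp: P_def s_def algebra_simps elim!: dvdE)
  have "(\<Sum>k\<in>A. g k * prod b (insert x A - {k})) = (\<Sum>k\<in>A. b x * (g k * prod b (A - {k})))"
  proof (rule sum.cong)
    fix k assume "k \<in> A"
    then have "insert x A - {k} = insert x (A - {k})" using insert by auto
    then show "g k * prod b (insert x A - {k}) = b x * (g k * prod b (A - {k}))"
      using insert by (simp add: mult_ac)
  qed simp
  then have s: "(\<Sum>k\<in>insert x A. g k * prod b (insert x A - {k})) = g x * prod b A + b x * s"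
    using insert by (simp add: s_def sum_distrib_left)
  \<comment> \<open>The terms of order below two cancel; what remains is the inherited remainder
    times \<open>b x\<close> and \<open>q * g x\<close> times the terms of positive order in
    \<open>P\<close>.\<close>
  have "(\<Prod>i\<in>insert x A. b i + q * g i) - (prod b (insert x A) + q * (g x * prod b A + b x * s))
      = q\<^sup>2 * (b x * r + g x * s + q * g x * r)"
    using insert by (simp add: P_def[symmetric] r algebra_simps power2_eq_square)
  then show ?case unfolding s by simp
qed simp

lemma lookup_of_nat_mult:
  "Poly_Mapping.lookup (of_nat k * P) e = int k * Poly_Mapping.lookup (P :: 'e::comm_monoid_add \<Rightarrow>\<^sub>0 int) e"
  by (induction k) (simp_all add: lookup_add algebra_simps)

lemma lookup_of_int_mult:
  "Poly_Mapping.lookup (of_int k * P) e = k * Poly_Mapping.lookup (P :: 'e::comm_monoid_add \<Rightarrow>\<^sub>0 int) e"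
  by (cases k rule: int_cases2) (simp_all add: lookup_of_nat_mult)

lemma lookup_numeral_mult:
  "Poly_Mapping.lookup (numeral k * P) e = numeral k * Poly_Mapping.lookup (P :: 'e::comm_monoid_add \<Rightarrow>\<^sub>0 int) e"
  using lookup_of_int_mult[of "numeral k" P e] by simp

text \<open>If p divides the coefficient of \<open>y\<close> at \<open>e\<close>, then
  \<open>of_nat p * y\<close> contributes a multiple of p^2 there, and the divisibility passes to
  \<open>x\<close> alone.\<close>

lemma square_dvd_lookup_first_order:
  fixes x y :: "'e::comm_monoid_add \<Rightarrow>\<^sub>0 int"
  assumes "of_nat (p\<^sup>2) dvd x + of_nat p * y" and "int p dvd Poly_Mapping.lookup y e"
  shows "(int p)\<^sup>2 dvd Poly_Mapping.lookup x e"
proof -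
  obtain K where "x + of_nat p * y = of_nat (p\<^sup>2) * K" using assms(1) by (elim dvdE)
  from arg_cong[OF this, of "\<lambda>P. Poly_Mapping.lookup P e"]
  have "Poly_Mapping.lookup x e + int p * Poly_Mapping.lookup y e = int (p\<^sup>2) * Poly_Mapping.lookup K e"
    by (simp only: lookup_add lookup_of_nat_mult)
  then have eq: "Poly_Mapping.lookup x e
      = (int p)\<^sup>2 * Poly_Mapping.lookup K e - int p * Poly_Mapping.lookup y e"
    by simp
  have "(int p)\<^sup>2 dvd int p * Poly_Mapping.lookup y e"
    using assms(2) by (simp add: power2_eq_square)
  then show ?thesis unfolding eq by (intro dvd_diff dvd_triv_left)
qed

text \<open>Expanding each product to first order produces Leibniz terms in which one factor
  \<open>b\<close> is replaced by \<open>g\<close>. Their coefficients at \<open>e\<close> are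
  divisible by p, so modulo p^2 only the products of the \<open>b\<close> are seen.\<close>

lemma dvd_lookup_sum_prod_first_order:
  fixes b g :: "'s \<Rightarrow> 'i \<Rightarrow> 'e::comm_monoid_add \<Rightarrow>\<^sub>0 int" and s :: "'s \<Rightarrow> int"
  assumes fin: "finite A"
    and sq: "of_nat (p\<^sup>2) dvd (\<Sum>\<sigma>\<in>S. of_int (s \<sigma>) * (\<Prod>i\<in>A. b \<sigma> i + of_nat p * g \<sigma> i))"
    and dvd: "\<And>\<sigma> k. \<sigma> \<in> S \<Longrightarrow> k \<in> A \<Longrightarrow>
          int p dvd Poly_Mapping.lookup (g \<sigma> k * prod (b \<sigma>) (A - {k})) e"
  shows "(int p)\<^sup>2 dvd Poly_Mapping.lookup (\<Sum>\<sigma>\<in>S. of_int (s \<sigma>) * prod (b \<sigma>) A) e"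
proof -
  define l where "l \<sigma> = (\<Sum>k\<in>A. g \<sigma> k * prod (b \<sigma>) (A - {k}))" for \<sigma>
  have pp: "of_nat (p\<^sup>2) = (of_nat p)\<^sup>2" by simp
  have "of_nat (p\<^sup>2) dvd (\<Sum>\<sigma>\<in>S. of_int (s \<sigma>) * ((\<Prod>i\<in>A. b \<sigma> i + of_nat p * g \<sigma> i)
      - (prod (b \<sigma>) A + of_nat p * l \<sigma>)))"
    unfolding l_def pp by (intro dvd_sum dvd_mult prod_first_order fin)
  from dvd_diff[OF sq this]
  have "of_nat (p\<^sup>2) dvd (\<Sum>\<sigma>\<in>S. of_int (s \<sigma>) * prod (b \<sigma>) A) + of_nat p * (\<Sum>\<sigma>\<in>S. of_int (s \<sigma>) * l \<sigma>)"
    by (simp add: sum_subtractf[symmetric] sum.distrib[symmetric] sum_distrib_left algebra_simps)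
  then show ?thesis
  proof (rule square_dvd_lookup_first_order)
    show "int p dvd Poly_Mapping.lookup (\<Sum>\<sigma>\<in>S. of_int (s \<sigma>) * l \<sigma>) e"
      unfolding lookup_sum lookup_of_int_mult l_def by (intro dvd_sum dvd_mult dvd)
  qed
qed

lemma square_dvd_lookup_det_n:
  fixes B G :: "nat \<Rightarrow> nat \<Rightarrow> 'e::comm_monoid_add \<Rightarrow>\<^sub>0 int"
  assumes "of_nat (p\<^sup>2) dvd det_n n (\<lambda>i j. B i j + of_nat p * G i j)"
    and "\<And>\<sigma> k. \<sigma> permutes {..<n} \<Longrightarrow> k < n \<Longrightarrow>
          int p dvd Poly_Mapping.lookup (G k (\<sigma> k) * (\<Prod>i\<in>{..<n} - {k}. B i (\<sigma> i))) e"
  shows "(int p)\<^sup>2 dvd Poly_Mapping.lookup (det_n n B) e"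
  unfolding det_n_def
proof (rule dvd_lookup_sum_prod_first_order)
  show "of_nat (p\<^sup>2) dvd (\<Sum>\<sigma> | \<sigma> permutes {..<n}.
      of_int (sign \<sigma>) * (\<Prod>i<n. B i (\<sigma> i) + of_nat p * G i (\<sigma> i)))"
    using assms(1) unfolding det_n_def .
qed (use assms(2) in blast)+

section \<open>Monomials in six indeterminates and powers of binomials\<close>

type_synonym exponents = "nat \<times> nat \<times> nat \<times> nat \<times> nat \<times> nat"

text \<open>The exponent vector of a k-th power. Tuples add componentwise, so equations between
  concrete monomials become arithmetic in the coordinates; six coordinates suffice for every test
  matrix.\<close>

definition scale :: "nat \<Rightarrow> exponents \<Rightarrow> exponents" where
  "scale k = (\<lambda>(x1, x2, x3, x4, x5, x6). (k * x1, k * x2, k * x3, k * x4, k * x5, k * x6))"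

lemma scale_simps [simp]:
  "scale k (x1, x2, x3, x4, x5, x6) = (k * x1, k * x2, k * x3, k * x4, k * x5, k * x6)"
  by (simp add: scale_def)

lemma zero_exponents: "(0 :: exponents) = (0, 0, 0, 0, 0, 0)"
  by (simp add: zero_prod_def)

lemma power_single: "Poly_Mapping.single x c ^ k = Poly_Mapping.single (scale k x) (c ^ k :: int)"
proof (induction k)
  case 0
  then show ?case by (cases x) (simp flip: zero_exponents)
next
  case (Suc k)
  then show ?case by (cases x) (simp add: mult_single)
qed

text \<open>Binomial theorem, where \<open>i\<close> counts the factors from which the monomial
  \<open>v\<close> is chosen.\<close>

lemma lookup_single_mult_binomial:
  fixes x v w e :: exponents and c s :: int
  shows "Poly_Mapping.lookup (Poly_Mapping.single x c *
      (Poly_Mapping.single w 1 + Poly_Mapping.single v s) ^ j) e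
    = (\<Sum>i\<le>j. if x + (scale i v + scale (j - i) w) = e then c * (s ^ i * int (j choose i)) else 0)"
proof -
  have "Poly_Mapping.single x c * (Poly_Mapping.single w 1 + Poly_Mapping.single v s) ^ j
      = (\<Sum>i\<le>j. Poly_Mapping.single (x + (scale i v + scale (j - i) w)) (c * (s ^ i * int (j choose i))))"
    unfolding add.commute[of "Poly_Mapping.single w 1"] binomial_ring sum_distrib_left
    by (intro sum.cong refl)
       (simp add: power_single mult_single of_nat_single ac_simps del: single_of_nat)
  then show ?thesis by (simp add: lookup_sum lookup_single when_def)
qed

lemma dvd_lookup_single_mult_binomial:
  fixes x v w e :: exponents and c s :: int
  assumes "\<And>i. i \<le> j \<Longrightarrow> x + (scale i v + scale (j - i) w) = e \<Longrightarrow> d dvd c * (s ^ i * int (j choose i))"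
  shows "d dvd Poly_Mapping.lookup (Poly_Mapping.single x c *
      (Poly_Mapping.single w 1 + Poly_Mapping.single v s) ^ j) e"
  unfolding lookup_single_mult_binomial using assms by (intro dvd_sum) auto

section \<open>Testing coefficients\<close>

text \<open>The points at which the hypersurface is tested have coordinates in the multiplicative
  monoid \<open>M\<close>, where \<open>Q\<close> records which monomials accompany a power of the binomial \<open>D\<close>.
  Products with the elements of \<open>N\<close> do not contribute to the coefficient of \<open>e\<close> modulo \<open>p\<close>.\<close>

locale coefficient_test =
  fixes Q :: "exponents \<Rightarrow> nat \<Rightarrow> bool" and w v :: exponents and s :: int and p :: nat and e :: exponents
  assumes Q_add: "Q x j \<Longrightarrow> Q y k \<Longrightarrow> Q (x + y) (j + k)" and Q_0: "Q 0 0"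
begin

definition D :: "exponents \<Rightarrow>\<^sub>0 int" where
  "D = Poly_Mapping.single w 1 + Poly_Mapping.single v s"

definition M :: "(exponents \<Rightarrow>\<^sub>0 int) set" where
  "M = {y. \<exists>x c j. y = Poly_Mapping.single x c * D ^ j \<and> Q x j}"

definition N :: "(exponents \<Rightarrow>\<^sub>0 int) set" where
  "N = {z. \<forall>y\<in>M. int p dvd Poly_Mapping.lookup (y * z) e}"

lemma M_I: "Q x j \<Longrightarrow> Poly_Mapping.single x c * D ^ j \<in> M"
  unfolding M_def by blast

lemma M_single: "Q x 0 \<Longrightarrow> Poly_Mapping.single x c \<in> M"
  using M_I[of x 0 c] by simp

lemma M_of_int: "of_int c \<in> M"
proof -
  have "Poly_Mapping.single 0 (of_int c) \<in> M" by (rule M_single) (rule Q_0)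
  then show ?thesis unfolding single_of_int .
qed

lemma M_0: "0 \<in> M" and M_1: "1 \<in> M"
  using M_of_int[of 0] M_of_int[of 1] by simp_all

lemma M_mult:
  assumes "a \<in> M" "b \<in> M"
  shows "a * b \<in> M"
proof -
  obtain x c j where a: "a = Poly_Mapping.single x c * D ^ j" "Q x j"
    using assms(1) unfolding M_def by blast
  obtain y d k where b: "b = Poly_Mapping.single y d * D ^ k" "Q y k"
    using assms(2) unfolding M_def by blast
  have "a * b = (Poly_Mapping.single x c * Poly_Mapping.single y d) * D ^ (j + k)"
    unfolding a(1) b(1) by (simp only: power_add mult_ac)
  then show ?thesis using M_I[OF Q_add[OF a(2) b(2)]] by (simp add: mult_single)
qed

lemma M_power: "a \<in> M \<Longrightarrow> a ^ k \<in> M"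
  by (induction k) (auto intro: M_mult M_1)

lemma N_0: "0 \<in> N"
  by (simp add: N_def)

lemma N_mult:
  assumes "z \<in> N" "a \<in> M"
  shows "z * a \<in> N" "a * z \<in> N"
proof -
  have "int p dvd Poly_Mapping.lookup (y * (a * z)) e" if "y \<in> M" for y
    using assms(1) M_mult[OF that assms(2)] unfolding N_def by (simp add: mult.assoc[symmetric])
  then show "a * z \<in> N" "z * a \<in> N"
    unfolding N_def by (simp_all add: mult.commute)
qed

lemma N_prod:
  assumes "finite A" "i \<in> A" "f i \<in> N" "\<And>j. j \<in> A \<Longrightarrow> f j \<in> M"
  shows "prod f A \<in> N"
proof -
  have "prod f B \<in> M" if "B \<subseteq> A" for B
    using that assms(4) by (induction B rule: infinite_finite_induct) (auto intro: M_1 M_mult)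
  then have "prod f (A - {i}) \<in> M" by auto
  then show ?thesis
    using N_mult(1)[OF assms(3)] assms(1,2) by (simp add: prod.remove)
qed

text \<open>Multiplied by an element of \<open>M\<close>, the factor is again a monomial times a
  power of \<open>D\<close>, so only the binomial terms with exponent \<open>e\<close> have to be
  inspected; \<open>Q\<close> limits which \<open>x\<close> and \<open>j\<close> occur.\<close>

lemma N_I:
  assumes "\<And>x j i c. Q x j \<Longrightarrow> i \<le> j + m \<Longrightarrow> x + a + (scale i v + scale (j + m - i) w) = e \<Longrightarrow>
          int p dvd (c * k) * (s ^ i * int ((j + m) choose i))"
  shows "Poly_Mapping.single a k * D ^ m \<in> N"
proof -
  have "int p dvd Poly_Mapping.lookup (Poly_Mapping.single x c * D ^ j * (Poly_Mapping.single a k * D ^ m)) e"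
    if "Q x j" for x c j
  proof -
    have "Poly_Mapping.single x c * D ^ j * (Poly_Mapping.single a k * D ^ m) =
        Poly_Mapping.single x c * Poly_Mapping.single a k * D ^ (j + m)"
      by (simp only: power_add mult_ac)
    also have "\<dots> = Poly_Mapping.single (x + a) (c * k) * D ^ (j + m)"
      by (simp add: mult_single)
    finally show ?thesis
      unfolding D_def by (simp only:) (rule dvd_lookup_single_mult_binomial, rule assms[OF that])
  qed
  then show ?thesis unfolding N_def M_def by blast
qed

lemma N_single:
  assumes "\<And>x j i c. Q x j \<Longrightarrow> i \<le> j \<Longrightarrow> x + a + (scale i v + scale (j - i) w) = e \<Longrightarrow>
          int p dvd (c * k) * (s ^ i * int (j choose i))"
  shows "Poly_Mapping.single a k \<in> N"
  using N_I[of 0 a k] assms by simp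

text \<open>This is how the unknown corrections are controlled: their values are sums of elements of
  \<open>M\<close>, whose products with \<open>z\<close> do not contribute modulo p.\<close>

lemma dvd_lookup_mpoly_eval_N:
  assumes "P \<in> mpolys V" "\<And>v. v \<in> V \<Longrightarrow> \<psi> v \<in> M" "z \<in> N"
  shows "int p dvd Poly_Mapping.lookup (mpoly_eval \<psi> P * z) e"
  by (rule dvd_lookup_mpoly_eval[OF assms(1) M_of_int M_mult assms(2)])
     (use assms(3) in \<open>auto simp: N_def\<close>)

end

section \<open>The test matrices\<close>

lemma prime_square_not_dvd_int:
  assumes "prime p"
  shows "\<not> (int p)\<^sup>2 dvd int p"
proof
  assume "(int p)\<^sup>2 dvd int p"
  then have "p\<^sup>2 dvd p" by (simp flip: of_nat_power)
  then show False using prime_ge_2_nat[OF assms] by (auto simp: power2_eq_square dest: dvd_imp_le)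
qed

section \<open>Case (a): generic determinants\<close>

text \<open>A rank two matrix \<open>((0, s, s a), (r, 0, r b), (c, d, a d + b c))\<close>, with exponent
  vectors written in the order \<open>s, r, a, b, c, d\<close>.\<close>

definition gen_point :: "nat \<Rightarrow> nat \<Rightarrow> exponents \<Rightarrow>\<^sub>0 int" where
  "gen_point i j =
    (if 3 \<le> max i j then (if i = j then 1 else 0)
     else if i = 0 \<and> j = 1 then Poly_Mapping.single (1,0,0,0,0,0) 1
     else if i = 0 \<and> j = 2 then Poly_Mapping.single (1,0,1,0,0,0) 1
     else if i = 1 \<and> j = 0 then Poly_Mapping.single (0,1,0,0,0,0) 1
     else if i = 1 \<and> j = 2 then Poly_Mapping.single (0,1,0,1,0,0) 1
     else if i = 2 \<and> j = 0 then Poly_Mapping.single (0,0,0,0,1,0) 1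
     else if i = 2 \<and> j = 1 then Poly_Mapping.single (0,0,0,0,0,1) 1
     else if i = 2 \<and> j = 2 then
       Poly_Mapping.single (0,0,1,0,0,1) 1 + Poly_Mapping.single (0,0,0,1,1,0) 1
     else 0)"

text \<open>The determinant of the matrix of p-th powers is s^p r^p (a^p d^p + b^p c^p - (a d + b
  c)^p). Its coefficient at s^p r^p a^(p-1) b c d^(p-1) is -p, which p^2 does not divide, whereas
  the first-order terms have coefficients divisible by p.\<close>

lemma frobenius_not_liftable_det:
  assumes p: "prime p" and n: "3 \<le> n"
  shows "\<not> (frob_lifts_mod_p2 (R_det n) p \<or> frob_lifts (R_det n) p)"
proof
  assume lifts: "frob_lifts_mod_p2 (R_det n) p \<or> frob_lifts (R_det n) p"
  have p2: "2 \<le> p" using p by (rule prime_ge_2_nat)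
  define \<psi> where "\<psi> = (\<lambda>(i, j). gen_point i j)"
  have f: "det_n n gen_matrix \<in> mpolys (gen_vars n)"
    by (rule det_n_mpolys) (simp add: gen_matrix_def gen_vars_def)
  have ev: "mpoly_eval \<phi> (det_n n gen_matrix) = det_n n (\<lambda>i j. \<phi> (i, j))"
    for \<phi> :: "nat \<times> nat \<Rightarrow> exponents \<Rightarrow>\<^sub>0 int"
    by (simp add: mpoly_eval_det_n gen_matrix_def)
  have "mpoly_eval \<psi> (det_n n gen_matrix) = det_n 3 gen_point"
    unfolding ev \<psi>_def using n
    by (simp, intro det_n_block_identity) (simp_all add: gen_point_def)
  also have "\<dots> = 0"
    by (simp add: det_n_3 gen_point_def mult_single algebra_simps)
  finally have zero: "mpoly_eval \<psi> (det_n n gen_matrix) = 0" .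
  obtain g where g: "\<And>v. g v \<in> mpolys (gen_vars n)"
    "of_nat (p\<^sup>2) dvd mpoly_eval (\<lambda>v. \<psi> v ^ p + of_nat p * mpoly_eval \<psi> (g v)) (det_n n gen_matrix)"
    using hyp_ring_lift_evaluation[OF f lifts[unfolded R_det_def] zero] by blast
  define B where "B i j = gen_point i j ^ p" for i j
  define G where "G i j = mpoly_eval \<psi> (g (i, j))" for i j
  have "(of_nat p)\<^sup>2 dvd det_n n (\<lambda>i j. B i j + of_nat p * G i j)"
    using g(2) unfolding ev by (simp add: B_def G_def \<psi>_def)
  then have "(of_nat p)\<^sup>2 dvd det_n 3 (\<lambda>i j. B i j + of_nat p * G i j)"
    by (rule square_dvd_det_n_reduce[OF n]) (use p2 in \<open>auto simp: B_def gen_point_def power_0_left\<close>)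
  then have sq: "of_nat (p\<^sup>2) dvd det_n 3 (\<lambda>i j. B i j + of_nat p * G i j)" by simp
  define e :: exponents where "e = (p, p, p - 1, 1, 1, p - 1)"
  define w v :: exponents where "w = (0,0,1,0,0,1)" and "v = (0,0,0,1,1,0)"
  \<comment> \<open>Outside powers of \<open>D\<close>, the indeterminate a occurs only together
    with s, and b only together with r.\<close>
  define Q :: "exponents \<Rightarrow> nat \<Rightarrow> bool" where "Q = (\<lambda>(x1,x2,x3,x4,x5,x6) j. x3 \<le> x1 \<and> x4 \<le> x2)"
  have Q: "Q (x1,x2,x3,x4,x5,x6) j \<longleftrightarrow> x3 \<le> x1 \<and> x4 \<le> x2" for x1 x2 x3 x4 x5 x6 j
    by (simp add: Q_def)
  interpret coefficient_test Q w v 1 p e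
  proof
    show "Q (x + y) (j + k)" if "Q x j" "Q y k" for x y j k
      using that by (cases x; cases y) (auto simp: Q)
    show "Q 0 0" by (simp add: Q zero_exponents)
  qed
  have "Q 0 1" by (simp add: Q zero_exponents)
  then have DM: "D \<in> M" using M_I[of 0 1 1] by simp
  have D: "gen_point 2 2 = D" unfolding D_def by (simp add: gen_point_def w_def v_def)
  have pM: "gen_point i j \<in> M" for i j
  proof (cases "i = 2 \<and> j = 2")
    case True
    then show ?thesis using D DM by simp
  next
    case False
    then show ?thesis
      by (simp add: gen_point_def Q M_single M_0 M_1 del: max.bounded_iff) auto
  qed
  have BM: "B i j \<in> M" for i j
    using pM unfolding B_def by (rule M_power)
  have N: "B i j \<in> N" if "(i, j) \<noteq> (0, 1)" "(i, j) \<noteq> (1, 0)" "i < 3" "j < 3" for i j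
  proof -
    have "B 0 2 \<in> N" "B 1 2 \<in> N" "B 2 0 \<in> N" "B 2 1 \<in> N"
      using p2 unfolding B_def gen_point_def
      by (simp_all add: power_single) (rule N_single; force simp: e_def w_def v_def)+
    moreover have "Poly_Mapping.single 0 1 * D ^ p \<in> N"
    proof (rule N_I)
      fix x j i and c :: int
      assume "Q x j" "i \<le> j + p" "x + 0 + (scale i v + scale (j + p - i) w) = e"
      \<comment> \<open>The exponent of c gives i at most 1, and that of a gives j + p - i at most p
        - 1; only \<open>p choose 1\<close> can occur.\<close>
      then have "i = 1 \<and> j = 0"
        using p2 by (cases x) (auto simp: e_def w_def v_def)
      then show "int p dvd (c * 1) * (1 ^ i * int ((j + p) choose i))" by simp
    qed
    then have "B 2 2 \<in> N" by (simp add: B_def D)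
    moreover have "B 0 0 = 0" "B 1 1 = 0" using p2 by (simp_all add: B_def gen_point_def power_0_left)
    ultimately show ?thesis
      using that N_0 by (auto simp: numeral_3_eq_3 numeral_2_eq_2 less_Suc_eq)
  qed
  have N': "B 0 1 * B 1 0 \<in> N"
  proof -
    have eq: "B 0 1 * B 1 0 = Poly_Mapping.single (p,p,0,0,0,0) 1"
      by (simp add: B_def gen_point_def power_single mult_single)
    show ?thesis unfolding eq
    proof (rule N_single)
      fix x j i and c :: int
      assume "Q x j" "i \<le> j" "x + (p,p,0,0,0,0) + (scale i v + scale (j - i) w) = e"
      \<comment> \<open>The factor exhausts s and r, so \<open>Q\<close> forbids a and b in
        \<open>x\<close>: they come from \<open>D\<close> alone, with b chosen once.\<close>
      then have "i = 1 \<and> j = p"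
        using p2 by (cases x) (auto simp: Q e_def w_def v_def)
      then show "int p dvd (c * 1) * (1 ^ i * int (j choose i))" by simp
    qed
  qed
  have "(int p)\<^sup>2 dvd Poly_Mapping.lookup (det_n 3 B) e"
  proof (rule square_dvd_lookup_det_n[OF sq])
    fix \<sigma> k assume \<sigma>: "\<sigma> permutes {..<3::nat}" and k: "k < (3::nat)"
    have \<sigma>3: "\<sigma> i < 3" if "i < 3" for i using permutes_in_image[OF \<sigma>, of i] that by auto
    have "(\<Prod>i\<in>{..<3} - {k}. B i (\<sigma> i)) \<in> N"
    \<comment> \<open>Either one of the two remaining rows has its entry in \<open>N\<close>, or the
      entries are those at (0,1) and (1,0), whose product lies in \<open>N\<close>.\<close>
    proof (cases "\<exists>i<3. i \<noteq> k \<and> (i, \<sigma> i) \<noteq> (0, 1) \<and> (i, \<sigma> i) \<noteq> (1, 0)")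
      case True
      then obtain i where "i < 3" "i \<noteq> k" "(i, \<sigma> i) \<noteq> (0, 1)" "(i, \<sigma> i) \<noteq> (1, 0)" by blast
      then show ?thesis
        by (intro N_prod[of _ i]) (use N \<sigma>3 BM in auto)
    next
      case False
      then have no: "(i, \<sigma> i) = (0, 1) \<or> (i, \<sigma> i) = (1, 0)" if "i < 3" "i \<noteq> k" for i using that by blast
      have "k = 2" using no[of 2] by auto
      moreover have "\<sigma> 0 = 1" "\<sigma> 1 = 0" using no[of 0] no[of 1] \<open>k = 2\<close> by auto
      moreover have "{..<3} - {2} = {0, 1::nat}" by auto
      ultimately show ?thesis using N' by simp
    qed
    then show "int p dvd Poly_Mapping.lookup (G k (\<sigma> k) * (\<Prod>i\<in>{..<3} - {k}. B i (\<sigma> i))) e"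
      unfolding G_def
      by (rule dvd_lookup_mpoly_eval_N[OF g(1), rotated]) (auto simp: \<psi>_def pM)
  qed
  moreover have "Poly_Mapping.lookup (det_n 3 B) e = - int p"
  proof -
    have 0: "B 0 0 = 0" "B 1 1 = 0" using p2 by (simp_all add: B_def gen_point_def power_0_left)
    have a: "B 0 1 * B 1 2 * B 2 0 = Poly_Mapping.single (p,p,0,p,p,0) 1"
      and b: "B 0 2 * B 1 0 * B 2 1 = Poly_Mapping.single (p,p,p,0,0,p) 1"
      and c: "B 0 1 * B 1 0 * B 2 2 = Poly_Mapping.single (p,p,0,0,0,0) 1 *
        (Poly_Mapping.single w 1 + Poly_Mapping.single v 1) ^ p"
      by (simp_all add: B_def gen_point_def power_single mult_single w_def v_def)
    have "Poly_Mapping.lookup (B 0 1 * B 1 0 * B 2 2) e = (\<Sum>i\<le>p. if i = 1 then int p else 0)"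
      unfolding c lookup_single_mult_binomial
      by (rule sum.cong) (use p2 in \<open>auto simp: e_def w_def v_def\<close>)
    then have "Poly_Mapping.lookup (B 0 1 * B 1 0 * B 2 2) e = int p" using p2 by simp
    then show ?thesis
      unfolding det_n_3 0 lookup_add lookup_minus a b lookup_single using p2 by (simp add: e_def when_def)
  qed
  ultimately show False using prime_square_not_dvd_int[OF p] by simp
qed

section \<open>Case (b): Pfaffians\<close>

text \<open>The entries above the diagonal of a matrix with vanishing Pfaffian: \<open>e, e a, e b\<close> in the
  first row, \<open>c, d\<close> in the second and \<open>a d - b c\<close> in the third, with exponent vectors
  written in the order \<open>e, a, b, c, d\<close> (and an unused last entry).\<close>

definition alt_point :: "nat \<Rightarrow> nat \<Rightarrow> exponents \<Rightarrow>\<^sub>0 int" where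
  "alt_point i j =
    (if 4 \<le> j then (if even i \<and> j = Suc i then 1 else 0)
     else if i = 0 \<and> j = 1 then Poly_Mapping.single (1,0,0,0,0,0) 1
     else if i = 0 \<and> j = 2 then Poly_Mapping.single (1,1,0,0,0,0) 1
     else if i = 0 \<and> j = 3 then Poly_Mapping.single (1,0,1,0,0,0) 1
     else if i = 1 \<and> j = 2 then Poly_Mapping.single (0,0,0,1,0,0) 1
     else if i = 1 \<and> j = 3 then Poly_Mapping.single (0,0,0,0,1,0) 1
     else if i = 2 \<and> j = 3 then
       Poly_Mapping.single (0,1,0,0,1,0) 1 + Poly_Mapping.single (0,0,1,1,0,0) (-1)
     else 0)"

text \<open>For p-th powers of the entries, the Pfaffian is e^p ((a d - b c)^p - a^p d^p + b^p c^p),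
  with e, a, b, c, d the indeterminates of \<open>alt_point\<close>. Its coefficient at e^p a^(p-1)
  b c d^(p-1) is -p.\<close>

lemma frobenius_not_liftable_pfaffian:
  assumes p: "prime p" and n: "4 \<le> n" "even n"
  shows "\<not> (frob_lifts_mod_p2 (R_pf n) p \<or> frob_lifts (R_pf n) p)"
proof
  assume lifts: "frob_lifts_mod_p2 (R_pf n) p \<or> frob_lifts (R_pf n) p"
  have p2: "2 \<le> p" using p by (rule prime_ge_2_nat)
  obtain k where k: "n = 2 * k" using n(2) by blast
  have k2: "2 \<le> k" using n k by simp
  define \<psi> where "\<psi> = (\<lambda>(i, j). alt_point i j)"
  have f: "pfaffian n alt_matrix \<in> mpolys (alt_vars n)"
    by (rule pfaffian_mpolys) (simp add: alt_matrix_def alt_vars_def)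
  define alt where "alt \<phi> i j = (if i < j then \<phi> (i, j) else if j < i then - \<phi> (j, i) else 0)"
    for \<phi> :: "nat \<times> nat \<Rightarrow> exponents \<Rightarrow>\<^sub>0 int" and i j
  have ev: "mpoly_eval \<phi> (pfaffian n alt_matrix) = pfaffian (2*k) (alt \<phi>)" for \<phi>
  proof -
    have "mpoly_eval \<phi> (alt_matrix i j) = alt \<phi> i j" for i j
      by (simp add: alt_matrix_def alt_def)
    then show ?thesis by (simp add: mpoly_eval_pfaffian k)
  qed
  have "mpoly_eval \<psi> (pfaffian n alt_matrix) = pfaffian (2*2) (alt \<psi>)"
    unfolding ev
    by (rule pfaffian_block_standard[OF k2]) (simp add: alt_def \<psi>_def alt_point_def)
  also have "\<dots> = 0"
    by (simp add: pfaffian_4 alt_def \<psi>_def alt_point_def mult_single algebra_simps single_uminus)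
  finally have zero: "mpoly_eval \<psi> (pfaffian n alt_matrix) = 0" .
  obtain g where g: "\<And>v. g v \<in> mpolys (alt_vars n)"
    "of_nat (p\<^sup>2) dvd mpoly_eval (\<lambda>v. \<psi> v ^ p + of_nat p * mpoly_eval \<psi> (g v)) (pfaffian n alt_matrix)"
    using hyp_ring_lift_evaluation[OF f lifts[unfolded R_pf_def] zero] by blast
  define B where "B i j = alt_point i j ^ p" for i j
  define G where "G i j = mpoly_eval \<psi> (g (i, j))" for i j
  define Y where "Y = alt (\<lambda>v. \<psi> v ^ p + of_nat p * mpoly_eval \<psi> (g v))"
  have Y: "Y i j = B i j + of_nat p * G i j" if "i < j" for i j
    using that by (simp add: Y_def alt_def B_def G_def \<psi>_def)
  have "(of_nat p)\<^sup>2 dvd pfaffian (2*k) Y"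
    using g(2) unfolding ev Y_def by simp
  then have "(of_nat p)\<^sup>2 dvd pfaffian (2*2) Y"
    by (rule square_dvd_pfaffian_reduce[OF k2]) (use p2 in \<open>simp add: Y B_def alt_point_def power_0_left\<close>)
  then have sq: "of_nat (p\<^sup>2) dvd Y 0 1 * Y 2 3 - Y 0 2 * Y 1 3 + Y 0 3 * Y 1 2"
    by (simp add: pfaffian_4)
  define x where "x = B 0 1 * B 2 3 - B 0 2 * B 1 3 + B 0 3 * B 1 2"
  \<comment> \<open>The part of the Pfaffian that is linear in the corrections \<open>G\<close>; the
    quadratic part carries the factor p^2.\<close>
  define y where "y = G 0 1 * B 2 3 + G 2 3 * B 0 1 - G 0 2 * B 1 3 - G 1 3 * B 0 2
    + G 0 3 * B 1 2 + G 1 2 * B 0 3"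
  have eq: "Y 0 1 * Y 2 3 - Y 0 2 * Y 1 3 + Y 0 3 * Y 1 2 = (x + of_nat p * y)
      + of_nat (p\<^sup>2) * (G 0 1 * G 2 3 - G 0 2 * G 1 3 + G 0 3 * G 1 2)"
    by (simp add: Y x_def y_def algebra_simps power2_eq_square)
  have xy: "of_nat (p\<^sup>2) dvd x + of_nat p * y"
    using sq unfolding eq by (rule dvd_add_left_iff[OF dvd_triv_left, THEN iffD1])
  define e :: exponents where "e = (p, p - 1, 1, 1, p - 1, 0)"
  define w v :: exponents where "w = (0,1,0,0,1,0)" and "v = (0,0,1,1,0,0)"
  \<comment> \<open>Outside powers of \<open>D\<close>, each a or b is accompanied by the first
    indeterminate.\<close>
  define Q :: "exponents \<Rightarrow> nat \<Rightarrow> bool" where "Q = (\<lambda>(x1,x2,x3,x4,x5,x6) j. x2 + x3 \<le> x1)"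
  have Q: "Q (x1,x2,x3,x4,x5,x6) j \<longleftrightarrow> x2 + x3 \<le> x1" for x1 x2 x3 x4 x5 x6 j
    by (simp add: Q_def)
  interpret coefficient_test Q w v "-1" p e
  proof
    show "Q (x + y) (j + k)" if "Q x j" "Q y k" for x y j k
      using that by (cases x; cases y) (auto simp: Q)
    show "Q 0 0" by (simp add: Q zero_exponents)
  qed
  have "Q 0 1" by (simp add: Q zero_exponents)
  then have DM: "D \<in> M" using M_I[of 0 1 1] by simp
  have D: "alt_point 2 3 = D" unfolding D_def by (simp add: alt_point_def w_def v_def)
  have pM: "alt_point i j \<in> M" for i j
  proof (cases "i = 2 \<and> j = 3")
    case True
    then show ?thesis using D DM by simp
  next
    case False
    then show ?thesis
      by (simp add: alt_point_def Q M_single M_0 M_1)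
  qed
  have "B 0 2 \<in> N" "B 0 3 \<in> N" "B 1 2 \<in> N" "B 1 3 \<in> N"
    using p2 unfolding B_def alt_point_def
    by (simp_all add: power_single) (rule N_single; force simp: e_def w_def v_def)+
  moreover have "B 0 1 \<in> N"
  proof -
    have eq: "B 0 1 = Poly_Mapping.single (p,0,0,0,0,0) 1"
      by (simp add: B_def alt_point_def power_single)
    show ?thesis unfolding eq
    proof (rule N_single)
      fix x j i and c :: int
      assume "Q x j" "i \<le> j" "x + (p,0,0,0,0,0) + (scale i v + scale (j - i) w) = e"
      \<comment> \<open>The first indeterminate is exhausted, so \<open>Q\<close> leaves
        \<open>D\<close> as the only source of a and b.\<close>
      then have "i = 1 \<and> j = p"
        using p2 by (cases x) (auto simp: Q e_def w_def v_def)
      then show "int p dvd (c * 1) * ((-1) ^ i * int (j choose i))" by simp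
    qed
  qed
  moreover have "B 2 3 \<in> N"
  proof -
    have "Poly_Mapping.single 0 1 * D ^ p \<in> N"
    proof (rule N_I)
      fix x j i and c :: int
      assume "Q x j" "i \<le> j + p" "x + 0 + (scale i v + scale (j + p - i) w) = e"
      then have "i = 1 \<and> j = 0"
        using p2 by (cases x) (auto simp: e_def w_def v_def)
      then show "int p dvd (c * 1) * ((-1) ^ i * int ((j + p) choose i))" by simp
    qed
    then show ?thesis by (simp add: B_def D)
  qed
  moreover have "int p dvd Poly_Mapping.lookup (G i j * z) e" if "z \<in> N" for i j z
    using that unfolding G_def
    by (rule dvd_lookup_mpoly_eval_N[OF g(1), rotated]) (auto simp: \<psi>_def pM)
  ultimately have "int p dvd Poly_Mapping.lookup y e"
    unfolding y_def lookup_add lookup_minus by (intro dvd_add dvd_diff)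
  with xy have "(int p)\<^sup>2 dvd Poly_Mapping.lookup x e"
    by (rule square_dvd_lookup_first_order)
  moreover have "Poly_Mapping.lookup x e = - int p"
  proof -
    have a: "B 0 2 * B 1 3 = Poly_Mapping.single (p,p,0,0,p,0) 1"
      and b: "B 0 3 * B 1 2 = Poly_Mapping.single (p,0,p,p,0,0) 1"
      and c: "B 0 1 * B 2 3 = Poly_Mapping.single (p,0,0,0,0,0) 1 *
        (Poly_Mapping.single w 1 + Poly_Mapping.single v (-1)) ^ p"
      by (simp_all add: B_def alt_point_def power_single mult_single w_def v_def)
    have "Poly_Mapping.lookup (B 0 1 * B 2 3) e = (\<Sum>i\<le>p. if i = 1 then - int p else 0)"
      unfolding c lookup_single_mult_binomial
      by (rule sum.cong) (use p2 in \<open>auto simp: e_def w_def v_def\<close>)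
    then have "Poly_Mapping.lookup (B 0 1 * B 2 3) e = - int p" using p2 by simp
    then show ?thesis
      unfolding x_def lookup_add lookup_minus a b lookup_single using p2 by (simp add: e_def when_def)
  qed
  ultimately show False using prime_square_not_dvd_int[OF p] by simp
qed

section \<open>Case (c) for odd primes: symmetric determinants\<close>

text \<open>The entries on and above the diagonal of the singular symmetric matrix
  \<open>((0, s, a, b), (s, 0, c, d), (a, c, 0, 0), (b, d, 0, z))\<close> with \<open>b = 2 s a y\<close>, \<open>d = 2 s c x\<close> and
  \<open>z = - 2 s a c (x - y)\<^sup>2\<close>; exponent vectors are written in the order \<open>s, a, c, x, y\<close>
  (and an unused last entry).\<close>

definition sym4_point :: "nat \<Rightarrow> nat \<Rightarrow> exponents \<Rightarrow>\<^sub>0 int" where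
  "sym4_point i j =
    (if 4 \<le> j then (if i = j then 1 else 0)
     else if i = 0 \<and> j = 1 then Poly_Mapping.single (1,0,0,0,0,0) 1
     else if i = 0 \<and> j = 2 then Poly_Mapping.single (0,1,0,0,0,0) 1
     else if i = 0 \<and> j = 3 then Poly_Mapping.single (1,1,0,0,1,0) 2
     else if i = 1 \<and> j = 2 then Poly_Mapping.single (0,0,1,0,0,0) 1
     else if i = 1 \<and> j = 3 then Poly_Mapping.single (1,0,1,1,0,0) 2
     else if i = 3 \<and> j = 3 then Poly_Mapping.single (1,1,1,0,0,0) (-2) *
       (Poly_Mapping.single (0,0,0,1,0,0) 1 + Poly_Mapping.single (0,0,0,0,1,0) (-1)) ^ 2
     else 0)"

lemma symdet_mpolys: "det_n n sym_matrix \<in> mpolys (sym_vars n)"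
  by (rule det_n_mpolys) (auto simp: sym_matrix_def sym_vars_def)

lemma mpoly_eval_symdet:
  "mpoly_eval \<phi> (det_n n sym_matrix) = det_n n (\<lambda>i j. \<phi> (min i j, max i j))"
  by (simp add: mpoly_eval_det_n sym_matrix_def)

text \<open>The 4 by 4 determinant is 2 s a c z + (a d - b c)^2, which vanishes for the chosen b, d
  and z. After p-th powers, s^(2p) a^(2p) c^(2p) x^(2p-1) y comes only from the first term, because
  (x^p - y^p)^2 lacks x^(2p-1) y. Its coefficient is -4 (-2)^p p, not divisible by p^2 for odd
  p.\<close>

lemma frobenius_not_liftable_symdet_odd:
  assumes p: "prime p" "p \<noteq> 2" and n: "4 \<le> n"
  shows "\<not> (frob_lifts_mod_p2 (R_symdet n) p \<or> frob_lifts (R_symdet n) p)"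
proof
  assume lifts: "frob_lifts_mod_p2 (R_symdet n) p \<or> frob_lifts (R_symdet n) p"
  have p2: "2 \<le> p" using p(1) by (rule prime_ge_2_nat)
  define \<psi> where "\<psi> = (\<lambda>(i, j). sym4_point i j)"
  define X where "X i j = sym4_point (min i j) (max i j)" for i j
  have X_simps: "X 0 0 = 0" "X 1 1 = 0" "X 2 2 = 0" "X 2 3 = 0" "X 3 2 = 0"
    "X 0 1 = Poly_Mapping.single (1,0,0,0,0,0) 1" "X 1 0 = Poly_Mapping.single (1,0,0,0,0,0) 1"
    "X 0 2 = Poly_Mapping.single (0,1,0,0,0,0) 1" "X 2 0 = Poly_Mapping.single (0,1,0,0,0,0) 1"
    "X 0 3 = Poly_Mapping.single (1,1,0,0,1,0) 2" "X 3 0 = Poly_Mapping.single (1,1,0,0,1,0) 2"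
    "X 1 2 = Poly_Mapping.single (0,0,1,0,0,0) 1" "X 2 1 = Poly_Mapping.single (0,0,1,0,0,0) 1"
    "X 1 3 = Poly_Mapping.single (1,0,1,1,0,0) 2" "X 3 1 = Poly_Mapping.single (1,0,1,1,0,0) 2"
    "X 3 3 = Poly_Mapping.single (1,1,1,0,0,0) (-2) *
       (Poly_Mapping.single (0,0,0,1,0,0) 1 + Poly_Mapping.single (0,0,0,0,1,0) (-1)) ^ 2"
    by (simp_all add: X_def sym4_point_def)
  have Xbig: "X i j = (if i = j then 1 else 0)" if "4 \<le> max i j" for i j
    using that by (auto simp: X_def sym4_point_def min_def max_def)
  have "mpoly_eval \<psi> (det_n n sym_matrix) = det_n n X"
    by (simp add: mpoly_eval_symdet \<psi>_def X_def[abs_def])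
  also have "\<dots> = det_n 4 X" by (rule det_n_block_identity[OF n Xbig])
  also have "\<dots> = 0"
    unfolding det_n_4 X_simps
    by (simp add: power2_eq_square distrib_left distrib_right mult_single, rule poly_mapping_eqI)
       (simp add: lookup_add lookup_minus lookup_single lookup_numeral_mult when_def)
  finally have zero: "mpoly_eval \<psi> (det_n n sym_matrix) = 0" .
  obtain g where g: "\<And>v. g v \<in> mpolys (sym_vars n)"
    "of_nat (p\<^sup>2) dvd mpoly_eval (\<lambda>v. \<psi> v ^ p + of_nat p * mpoly_eval \<psi> (g v)) (det_n n sym_matrix)"
    using hyp_ring_lift_evaluation[OF symdet_mpolys lifts[unfolded R_symdet_def] zero] by blast
  define B where "B i j = X i j ^ p" for i j
  define G where "G i j = mpoly_eval \<psi> (g (min i j, max i j))" for i j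
  have "(of_nat p)\<^sup>2 dvd det_n n (\<lambda>i j. B i j + of_nat p * G i j)"
    using g(2) unfolding mpoly_eval_symdet by (simp add: B_def G_def \<psi>_def X_def)
  then have "(of_nat p)\<^sup>2 dvd det_n 4 (\<lambda>i j. B i j + of_nat p * G i j)"
    by (rule square_dvd_det_n_reduce[OF n]) (use p2 in \<open>simp add: B_def Xbig power_0_left\<close>)
  then have sq: "of_nat (p\<^sup>2) dvd det_n 4 (\<lambda>i j. B i j + of_nat p * G i j)" by simp
  define e :: exponents where "e = (2*p, 2*p, 2*p, 2*p - 1, 1, 0)"
  define w v :: exponents where "w = (0,0,0,1,0,0)" and "v = (0,0,0,0,1,0)"
  \<comment> \<open>Each y in b brings s and a, each x in d brings s and c, and each square of
    \<open>D\<close> in z brings s, a and c. The inequalities are doubled because \<open>j\<close>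
    counts single factors \<open>D\<close>.\<close>
  define Q :: "exponents \<Rightarrow> nat \<Rightarrow> bool" where
    "Q = (\<lambda>(x1,x2,x3,x4,x5,x6) j. even j \<and> 2*x4 + 2*x5 + j \<le> 2*x1 \<and> 2*x5 + j \<le> 2*x2 \<and> 2*x4 + j \<le> 2*x3)"
  have Q: "Q (x1,x2,x3,x4,x5,x6) j \<longleftrightarrow>
      even j \<and> 2*x4 + 2*x5 + j \<le> 2*x1 \<and> 2*x5 + j \<le> 2*x2 \<and> 2*x4 + j \<le> 2*x3" for x1 x2 x3 x4 x5 x6 j
    by (simp add: Q_def)
  interpret coefficient_test Q w v "-1" p e
  proof
    show "Q (x + y) (j + k)" if "Q x j" "Q y k" for x y j k
      using that by (cases x; cases y) (auto simp: Q)
    show "Q 0 0" by (simp add: Q zero_exponents)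
  qed
  have X33: "X 3 3 = Poly_Mapping.single (1,1,1,0,0,0) (-2) * D ^ 2"
    unfolding D_def X_simps by (simp add: w_def v_def)
  have pM: "sym4_point i j \<in> M" for i j
  proof (cases "i = 3 \<and> j = 3")
    case True
    have "X 3 3 \<in> M" unfolding X33 by (rule M_I) (simp add: Q)
    then show ?thesis using True by (simp add: X_def)
  next
    case False
    then show ?thesis
      by (simp add: sym4_point_def Q M_single M_0 M_1) auto
  qed
  have BM: "B i j \<in> M" for i j
    using pM unfolding B_def X_def by (rule M_power)
  define S A b C d Z where "S = B 0 1" and "A = B 0 2" and "b = B 0 3" and "C = B 1 2" and "d = B 1 3"
    and "Z = B 3 3"
  have B_simps: "B 0 0 = 0" "B 1 1 = 0" "B 2 2 = 0" "B 2 3 = 0" "B 3 2 = 0"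
    "B 0 1 = S" "B 1 0 = S" "B 0 2 = A" "B 2 0 = A" "B 0 3 = b" "B 3 0 = b"
    "B 1 2 = C" "B 2 1 = C" "B 1 3 = d" "B 3 1 = d" "B 3 3 = Z"
    using p2 unfolding S_def A_def b_def C_def d_def Z_def B_def X_simps by (simp_all add: power_0_left)
  have singles: "S = Poly_Mapping.single (p,0,0,0,0,0) 1" "A = Poly_Mapping.single (0,p,0,0,0,0) 1"
    "b = Poly_Mapping.single (p,p,0,0,p,0) (2^p)" "C = Poly_Mapping.single (0,0,p,0,0,0) 1"
    "d = Poly_Mapping.single (p,0,p,p,0,0) (2^p)"
    unfolding S_def A_def b_def C_def d_def B_def X_simps by (simp_all add: power_single)
  have Z: "Z = Poly_Mapping.single (p,p,p,0,0,0) ((-2)^p) * D ^ (2*p)"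
    unfolding Z_def B_def X33 by (simp add: power_mult_distrib power_single power_mult)
  have N_b: "b \<in> N" unfolding singles
    by (rule N_single) (use p2 in \<open>auto simp: e_def w_def v_def\<close>)
  have N_Z: "Z \<in> N" unfolding Z
  proof (rule N_I)
    fix x j i and c :: int
    assume "Q x j" "i \<le> j + 2*p" "x + (p,p,p,0,0,0) + (scale i v + scale (j + 2*p - i) w) = e"
    then have "i = 1 \<and> j = 0"
      using p2 by (cases x) (auto simp: Q e_def w_def v_def)
    then show "int p dvd (c * (-2)^p) * ((-1) ^ i * int ((j + 2*p) choose i))" by simp
  qed
  have N_dd: "d * d \<in> N" unfolding singles mult_single
    by (rule N_single) (use p2 in \<open>auto simp: e_def w_def v_def\<close>)
  \<comment> \<open>In the next three products a, s or c respectively is already exhausted, so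
    \<open>Q\<close> rules out the powers of x or y still missing from \<open>e\<close>.\<close>
  have N_AAd: "A * A * d \<in> N" unfolding singles mult_single
    by (rule N_single) (use p2 in \<open>auto simp: Q e_def w_def v_def\<close>)
  have N_SAd: "S * A * d \<in> N" unfolding singles mult_single
    by (rule N_single) (use p2 in \<open>auto simp: Q e_def w_def v_def\<close>)
  have N_ACd: "A * C * d \<in> N" unfolding singles mult_single
    by (rule N_single) (use p2 in \<open>auto simp: Q e_def w_def v_def\<close>)
  have N_SAC: "S * A * C \<in> N" unfolding singles mult_single
  proof (rule N_single)
    fix x j i and c :: int
    assume "Q x j" "i \<le> j" "x + ((p,0,0,0,0,0) + (0,p,0,0,0,0) + (0,0,p,0,0,0)) + (scale i v + scale (j - i) w) = e"
    \<comment> \<open>Only s^p is left, so \<open>Q\<close> allows total degree 2p in x and y only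
      if all of it comes from \<open>D\<close>.\<close>
    then have "i = 1 \<and> j = 2*p"
      using p2 by (cases x) (auto simp: Q e_def w_def v_def)
    then show "int p dvd (c * (1 * 1 * 1)) * ((-1) ^ i * int (j choose i))" by simp
  qed
  have N_ddA: "d * d * A \<in> N" using N_mult(1)[OF N_dd] BM[of 0 2] by (simp add: A_def)
  have "(int p)\<^sup>2 dvd Poly_Mapping.lookup (det_n 4 B) e"
  proof (rule square_dvd_lookup_det_n[OF sq])
    fix \<sigma> k assume \<sigma>: "\<sigma> permutes {..<4::nat}" and k: "k < (4::nat)"
    have \<sigma>4: "\<sigma> i < 4" if "i < 4" for i using permutes_in_image[OF \<sigma>, of i] that by auto
    have inj: "\<sigma> i = \<sigma> j \<Longrightarrow> i = j" for i j using permutes_inj[OF \<sigma>] by (rule injD)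
    \<comment> \<open>The positions of s, a, c and d, whose powers are not shown to lie in
      \<open>N\<close> individually. Products staying inside these positions follow few patterns,
      sorted by the omitted row \<open>k\<close>.\<close>
    let ?T = "{(0,1),(1,0),(0,2),(2,0),(1,2),(2,1),(1,3),(3,1)} :: (nat \<times> nat) set"
    have "(\<Prod>i\<in>{..<4} - {k}. B i (\<sigma> i)) \<in> N"
    proof (cases "\<exists>i<4. i \<noteq> k \<and> (i, \<sigma> i) \<notin> ?T")
      case True
      then obtain i where i: "i < 4" "i \<noteq> k" "(i, \<sigma> i) \<notin> ?T" by blast
      have "i = 0 \<or> i = 1 \<or> i = 2 \<or> i = 3" "\<sigma> i = 0 \<or> \<sigma> i = 1 \<or> \<sigma> i = 2 \<or> \<sigma> i = 3"
        using i(1) \<sigma>4[OF i(1)] by auto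
      then have "B i (\<sigma> i) \<in> N"
        using i(3) by (elim disjE) (simp_all add: B_simps[unfolded One_nat_def] N_0 N_b N_Z)
      then show ?thesis
        using i by (intro N_prod[of _ i]) (auto intro: BM)
    next
      case False
      then have no: "(i, \<sigma> i) \<in> ?T" if "i < 4" "i \<noteq> k" for i using that by blast
      consider "k = 0" | "k = 1" | "k = 2" | "k = 3" using k by linarith
      then show ?thesis
      proof cases
        case 1
        have "\<sigma> 3 = 1" "\<sigma> 2 = 0" "\<sigma> 1 = 2 \<or> \<sigma> 1 = 3"
          using no[of 1] no[of 2] no[of 3] inj[of 1 2] inj[of 2 3] 1 by auto
        moreover have "B 1 2 * (B 2 0 * B 3 1) \<in> N" "B 1 3 * (B 2 0 * B 3 1) \<in> N"
          using N_ACd N_ddA unfolding B_simps by (simp_all only: mult_ac)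
        moreover have "(\<Prod>i\<in>{..<4} - {k}. B i (\<sigma> i)) = B 1 (\<sigma> 1) * (B 2 (\<sigma> 2) * B 3 (\<sigma> 3))"
        proof -
          have "{..<4} - {k} = {1, 2, 3}" using 1 by auto
          then show ?thesis by simp
        qed
        ultimately show ?thesis by metis
      next
        case 2
        have "\<sigma> 3 = 1" "\<sigma> 0 = 2" "\<sigma> 2 = 0"
          using no[of 0] no[of 2] no[of 3] inj[of 0 3] inj[of 2 3] 2 by auto
        moreover have "B 0 2 * (B 2 0 * B 3 1) \<in> N"
          using N_AAd unfolding B_simps by (simp_all only: mult_ac)
        moreover have "(\<Prod>i\<in>{..<4} - {k}. B i (\<sigma> i)) = B 0 (\<sigma> 0) * (B 2 (\<sigma> 2) * B 3 (\<sigma> 3))"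
        proof -
          have "{..<4} - {k} = {0, 2, 3}" using 2 by auto
          then show ?thesis by simp
        qed
        ultimately show ?thesis by metis
      next
        case 3
        have "\<sigma> 3 = 1" "\<sigma> 0 = 2" "\<sigma> 1 = 0 \<or> \<sigma> 1 = 3"
          using no[of 0] no[of 1] no[of 3] inj[of 0 3] inj[of 0 1] 3 by auto
        moreover have "B 0 2 * (B 1 0 * B 3 1) \<in> N" "B 0 2 * (B 1 3 * B 3 1) \<in> N"
          using N_SAd N_ddA unfolding B_simps by (simp_all only: mult_ac)
        moreover have "(\<Prod>i\<in>{..<4} - {k}. B i (\<sigma> i)) = B 0 (\<sigma> 0) * (B 1 (\<sigma> 1) * B 3 (\<sigma> 3))"
        proof -
          have "{..<4} - {k} = {0, 1, 3}" using 3 by auto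
          then show ?thesis by simp
        qed
        ultimately show ?thesis by metis
      next
        case 4
        have "(\<sigma> 0 = 1 \<and> \<sigma> 1 = 2 \<and> \<sigma> 2 = 0) \<or> (\<sigma> 0 = 1 \<and> \<sigma> 1 = 3 \<and> \<sigma> 2 = 0) \<or>
          (\<sigma> 0 = 2 \<and> \<sigma> 1 = 0 \<and> \<sigma> 2 = 1) \<or> (\<sigma> 0 = 2 \<and> \<sigma> 1 = 3 \<and> \<sigma> 2 = 0) \<or>
          (\<sigma> 0 = 2 \<and> \<sigma> 1 = 3 \<and> \<sigma> 2 = 1)"
          using no[of 0] no[of 1] no[of 2] inj[of 0 1] inj[of 0 2] inj[of 1 2] 4 by auto
        moreover have "B 0 1 * (B 1 2 * B 2 0) \<in> N" "B 0 1 * (B 1 3 * B 2 0) \<in> N"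
          "B 0 2 * (B 1 0 * B 2 1) \<in> N" "B 0 2 * (B 1 3 * B 2 0) \<in> N" "B 0 2 * (B 1 3 * B 2 1) \<in> N"
          using N_SAC N_SAd N_AAd N_ACd unfolding B_simps by (simp_all only: mult_ac)
        moreover have "(\<Prod>i\<in>{..<4} - {k}. B i (\<sigma> i)) = B 0 (\<sigma> 0) * (B 1 (\<sigma> 1) * B 2 (\<sigma> 2))"
        proof -
          have "{..<4} - {k} = {0, 1, 2}" using 4 by auto
          then show ?thesis by simp
        qed
        ultimately show ?thesis by (elim disjE conjE) (simp_all only:)
      qed
    qed
    then show "int p dvd Poly_Mapping.lookup (G k (\<sigma> k) * (\<Prod>i\<in>{..<4} - {k}. B i (\<sigma> i))) e"
      unfolding G_def
      by (rule dvd_lookup_mpoly_eval_N[OF g(1), rotated]) (auto simp: \<psi>_def pM)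
  qed
  moreover have "Poly_Mapping.lookup (det_n 4 B) e = - (4 * (-2) ^ p) * int p"
  proof -
    have det: "det_n 4 B = S * A * C * Z + S * A * C * Z + A * A * (d * d)
        - A * b * (C * d) - A * b * (C * d) + b * b * (C * C)"
      unfolding det_n_4 B_simps by (simp add: mult_ac)
    have SACZ: "S * A * C * Z = Poly_Mapping.single (2*p,2*p,2*p,0,0,0) ((-2)^p) *
        (Poly_Mapping.single w 1 + Poly_Mapping.single v (-1)) ^ (2*p)"
      unfolding Z singles D_def mult.assoc[symmetric] mult_single by (simp add: mult_2)
    have "Poly_Mapping.lookup (S * A * C * Z) e = (\<Sum>i\<le>2*p. if i = 1 then - ((-2)^p * (2 * int p)) else 0)"
      unfolding SACZ lookup_single_mult_binomial
      by (rule sum.cong) (use p2 in \<open>auto simp: e_def w_def v_def\<close>)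
    then have 1: "Poly_Mapping.lookup (S * A * C * Z) e = - ((-2)^p * (2 * int p))" using p2 by simp
    have 2: "Poly_Mapping.lookup (A * A * (d * d)) e = 0" "Poly_Mapping.lookup (A * b * (C * d)) e = 0"
      "Poly_Mapping.lookup (b * b * (C * C)) e = 0"
      unfolding singles mult_single lookup_single using p2 by (auto simp: e_def when_def)
    show ?thesis unfolding det lookup_add lookup_minus 1 2 by simp
  qed
  ultimately have "int p * int p dvd int p * (4 * (-2) ^ p)"
    by (simp add: power2_eq_square mult_ac)
  \<comment> \<open>Cancelling one p leaves a power of 2 up to sign, which no odd prime
    divides.\<close>
  then have "int p dvd 2 ^ 2 * (-2) ^ p" using p2 by (subst (asm) dvd_mult_cancel_left) simp
  moreover have "prime (int p)" using p(1) by simp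
  ultimately have "int p dvd 2"
    by (metis dvd_minus_iff prime_dvd_mult_iff prime_dvd_power)
  then show False using p p2 by (auto dest!: zdvd_imp_le)
qed

section \<open>Case (c) for the prime 2\<close>

text \<open>The entries on and above the diagonal of the singular symmetric matrix
  \<open>((0, a, a b), (a, 0, c), (a b, c, 2 b c))\<close>; exponent vectors are written in the order
  \<open>a, b, c\<close> (and three unused entries).\<close>

definition sym3_point :: "nat \<Rightarrow> nat \<Rightarrow> exponents \<Rightarrow>\<^sub>0 int" where
  "sym3_point i j =
    (if 3 \<le> j then (if i = j then 1 else 0)
     else if i = 0 \<and> j = 1 then Poly_Mapping.single (1,0,0,0,0,0) 1
     else if i = 0 \<and> j = 2 then Poly_Mapping.single (1,1,0,0,0,0) 1
     else if i = 1 \<and> j = 2 then Poly_Mapping.single (0,0,1,0,0,0) 1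
     else if i = 2 \<and> j = 2 then Poly_Mapping.single (0,1,1,0,0,0) 2
     else 0)"

text \<open>After squaring the entries the determinant is 2 a^4 b^2 c^2 - 4 a^4 b^2 c^2 = -2 a^4 b^2
  c^2, which is not divisible by 4. By symmetry the first-order terms of off-diagonal corrections
  carry an additional factor 2, so only the diagonal corrections remain modulo 4.\<close>

lemma frobenius_not_liftable_symdet_two:
  assumes n: "3 \<le> n"
  shows "\<not> (frob_lifts_mod_p2 (R_symdet n) 2 \<or> frob_lifts (R_symdet n) 2)"
proof
  assume lifts: "frob_lifts_mod_p2 (R_symdet n) 2 \<or> frob_lifts (R_symdet n) 2"
  define \<psi> where "\<psi> = (\<lambda>(i, j). sym3_point i j)"
  define X where "X i j = sym3_point (min i j) (max i j)" for i j
  have X_simps: "X 0 0 = 0" "X 1 1 = 0"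
    "X 0 1 = Poly_Mapping.single (1,0,0,0,0,0) 1" "X 1 0 = Poly_Mapping.single (1,0,0,0,0,0) 1"
    "X 0 2 = Poly_Mapping.single (1,1,0,0,0,0) 1" "X 2 0 = Poly_Mapping.single (1,1,0,0,0,0) 1"
    "X 1 2 = Poly_Mapping.single (0,0,1,0,0,0) 1" "X 2 1 = Poly_Mapping.single (0,0,1,0,0,0) 1"
    "X 2 2 = Poly_Mapping.single (0,1,1,0,0,0) 2"
    by (simp_all add: X_def sym3_point_def)
  have Xbig: "X i j = (if i = j then 1 else 0)" if "3 \<le> max i j" for i j
    using that by (auto simp: X_def sym3_point_def min_def max_def)
  have "mpoly_eval \<psi> (det_n n sym_matrix) = det_n n X"
    by (simp add: mpoly_eval_symdet \<psi>_def X_def[abs_def])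
  also have "\<dots> = det_n 3 X" by (rule det_n_block_identity[OF n Xbig])
  also have "\<dots> = 0"
    unfolding det_n_3 X_simps
    by (simp add: mult_single, rule poly_mapping_eqI)
       (simp add: lookup_add lookup_minus lookup_single lookup_numeral_mult when_def)
  finally have zero: "mpoly_eval \<psi> (det_n n sym_matrix) = 0" .
  obtain g where g: "\<And>v. g v \<in> mpolys (sym_vars n)"
    "of_nat (2\<^sup>2) dvd mpoly_eval (\<lambda>v. \<psi> v ^ 2 + of_nat 2 * mpoly_eval \<psi> (g v)) (det_n n sym_matrix)"
    using hyp_ring_lift_evaluation[OF symdet_mpolys lifts[unfolded R_symdet_def] zero] by blast
  define B where "B i j = X i j ^ 2" for i j
  define G where "G i j = mpoly_eval \<psi> (g (min i j, max i j))" for i j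
  define Y where "Y i j = B i j + of_nat 2 * G i j" for i j
  have "(of_nat 2)\<^sup>2 dvd det_n n Y"
    using g(2) unfolding mpoly_eval_symdet
    by (simp add: B_def[abs_def] G_def[abs_def] \<psi>_def X_def[abs_def] Y_def[abs_def])
  then have "(of_nat 2)\<^sup>2 dvd det_n 3 Y"
    by (rule square_dvd_det_n_reduce[OF n]) (simp add: Y_def B_def Xbig)
  then have sq: "of_nat (2\<^sup>2) dvd det_n 3 Y" by simp
  define A b C Z where "A = B 0 1" and "b = B 0 2" and "C = B 1 2" and "Z = B 2 2"
  have B_simps: "B 0 0 = 0" "B 1 1 = 0" "B 0 1 = A" "B 1 0 = A" "B 0 2 = b" "B 2 0 = b"
    "B 1 2 = C" "B 2 1 = C" "B 2 2 = Z"
    unfolding A_def b_def C_def Z_def B_def X_simps by simp_all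
  have G_sym: "G 1 0 = G 0 1" "G 2 0 = G 0 2" "G 2 1 = G 1 2" by (simp_all add: G_def)
  define x where "x = 2 * A * b * C - Z * A\<^sup>2"
  define y where "y = - (G 0 0 * C\<^sup>2 + G 1 1 * b\<^sup>2 + G 2 2 * A\<^sup>2)"
  have eq: "det_n 3 Y = (x + of_nat 2 * y) + of_nat (2\<^sup>2) *
     (G 0 0 * G 1 1 * (Z + 2 * G 2 2)
      + (G 0 1 * (b + 2 * G 0 2) * (C + 2 * G 1 2) + A * G 0 2 * (C + 2 * G 1 2) + A * b * G 1 2)
      - 2 * G 0 0 * (G 1 2 * C + (G 1 2)\<^sup>2) - 2 * G 1 1 * (G 0 2 * b + (G 0 2)\<^sup>2)
      - (Z + 2 * G 2 2) * (G 0 1 * A + (G 0 1)\<^sup>2))"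
    unfolding det_n_3 Y_def B_simps G_sym x_def y_def by (simp add: algebra_simps power2_eq_square)
  have xy: "of_nat (2\<^sup>2) dvd x + of_nat 2 * y"
    using sq unfolding eq by (rule dvd_add_left_iff[OF dvd_triv_left, THEN iffD1])
  define e :: exponents where "e = (4, 2, 2, 0, 0, 0)"
  \<comment> \<open>The exponent of b exceeds that of a only when the coefficient is even, as in the
    entry 2 b c. Since coefficients enter the condition, \<open>M\<close> is set up here
    directly.\<close>
  define M :: "(exponents \<Rightarrow>\<^sub>0 int) set" where
    "M = {Poly_Mapping.single (x1, x2, x3, x4, x5, x6) c | x1 x2 x3 x4 x5 x6 c. x2 \<le> x1 \<or> even c}"
  have M_I: "Poly_Mapping.single (x1, x2, x3, x4, x5, x6) c \<in> M" if "x2 \<le> x1 \<or> even c" for x1 x2 x3 x4 x5 x6 c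
    using that unfolding M_def by blast
  have M_int: "of_int c \<in> M" for c
  proof -
    have "Poly_Mapping.single 0 (of_int c) \<in> M" unfolding zero_exponents by (rule M_I) simp
    then show ?thesis unfolding single_of_int .
  qed
  have M_mult: "a * a' \<in> M" if a: "a \<in> M" "a' \<in> M" for a a'
  proof -
    obtain x1 x2 x3 x4 x5 x6 c where 1: "a = Poly_Mapping.single (x1, x2, x3, x4, x5, x6) c" "x2 \<le> x1 \<or> even c"
      using a(1) unfolding M_def by blast
    obtain y1 y2 y3 y4 y5 y6 d where 2: "a' = Poly_Mapping.single (y1, y2, y3, y4, y5, y6) d" "y2 \<le> y1 \<or> even d"
      using a(2) unfolding M_def by blast
    show ?thesis unfolding 1(1) 2(1) mult_single add_Pair by (rule M_I) (use 1(2) 2(2) in auto)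
  qed
  have M01: "0 \<in> M" "1 \<in> M" using M_int[of 0] M_int[of 1] by simp_all
  have pM: "sym3_point i j \<in> M" for i j
    using M01 by (simp add: sym3_point_def M_I)
  have squares: "A = Poly_Mapping.single (2,0,0,0,0,0) 1" "b = Poly_Mapping.single (2,2,0,0,0,0) 1"
    "C = Poly_Mapping.single (0,0,2,0,0,0) 1" "Z = Poly_Mapping.single (0,2,2,0,0,0) 4"
    unfolding A_def b_def C_def Z_def B_def X_simps by (simp_all add: power_single)
  \<comment> \<open>The monomials \<open>b\<^sup>2\<close> and \<open>C\<^sup>2\<close> exceed the
    exponents of \<open>e\<close>; \<open>A\<^sup>2\<close> leaves b^2 c^2, in which b occurs
    without a, so the coefficient is even.\<close>
  have "2 dvd Poly_Mapping.lookup (G i j * z) e"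
    if "z = A\<^sup>2 \<or> z = b\<^sup>2 \<or> z = C\<^sup>2" for i j z
    unfolding G_def
  proof (rule dvd_lookup_mpoly_eval[OF g(1) M_int M_mult])
    show "\<psi> v \<in> M" for v by (cases v) (simp add: \<psi>_def pM)
    fix m assume "m \<in> M"
    then show "2 dvd Poly_Mapping.lookup (m * z) e"
      using that unfolding M_def squares power_single
      by (auto simp: mult_single lookup_single when_def e_def)
  qed
  then have "int 2 dvd Poly_Mapping.lookup y e"
    unfolding y_def lookup_add lookup_uminus by (auto intro!: dvd_add)
  with xy have "(int 2)\<^sup>2 dvd Poly_Mapping.lookup x e"
    by (rule square_dvd_lookup_first_order)
  moreover have "Poly_Mapping.lookup x e = - 2"
    unfolding x_def lookup_minus mult.assoc lookup_numeral_mult squares power_single mult_single lookup_single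
    by (simp add: e_def when_def)
  ultimately show False by simp
qed

theorem theorem1p4:
  fixes p n :: nat
  assumes "prime p"
  shows "(n \<ge> 3 \<longrightarrow> \<not> frob_lifts_mod_p2 (R_det n) p \<and> \<not> frob_lifts (R_det n) p)
       \<and> (n \<ge> 4 \<and> even n \<longrightarrow> \<not> frob_lifts_mod_p2 (R_pf n) p \<and> \<not> frob_lifts (R_pf n) p)
       \<and> (n \<ge> 3 \<and> (p = 2 \<or> (p > 2 \<and> n \<ge> 4)) \<longrightarrow>
            \<not> frob_lifts_mod_p2 (R_symdet n) p \<and> \<not> frob_lifts (R_symdet n) p)"
  using frobenius_not_liftable_det[OF assms] frobenius_not_liftable_pfaffian[OF assms]
    frobenius_not_liftable_symdet_odd[OF assms] frobenius_not_liftable_symdet_two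
  by auto

end
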